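(* (a) The system obtained from $\mathsf{CM}^- + \mathsf{NEC}$ by adding the axiom schema $$\mathsf{T}_{\mathsf{CM}}:\quad \mathsf{Tr}^\Box(\ulcorner\sigma\urcorner)\rightarrow\sigma\qquad\text{for every sentence }\sigma\text{ of }\mathcal{L}_{\mathsf{Uni},\mathsf{Mod}}$$ is inconsistent. (b) The system obtained from $\mathsf{CM}^- + \mathsf{NEC} + \textsf{Non-Triviality}$ by adding the axiom schema $$\mathsf{4}_{\mathsf{CM}}:\quad \mathsf{Tr}^\Box(\ulcorner\sigma\urcorner)\rightarrow\mathsf{Tr}^\Box(\ulcorner\mathsf{Tr}^\Box(\ulcorner\sigma\urcorner)\urcorner)\qquad\text{for every sentence }\sigma\text{ of }\mathcal{L}_{\mathsf{Uni},\mathsf{Mod}}$$ is inconsistent.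
   Context: **Languages and coding.** $\mathcal{L}$ is the language of set theory, with the binary symbol $\in$ together with finitely many symbols for arithmetic and for syntactic operations on Gödel codes; these are treated as defined (eliminable) symbols whose defining axioms are part of $\mathsf{ZF}$. $\mathcal{L}_{\mathsf{Uni},\mathsf{Mod}}$ is $\mathcal{L}$ augmented with a new unary relation symbol $\mathsf{Uni}$ and a new ternary relation symbol $\mathsf{Mod}$. $\ulcorner\phi\urcorner$ is the Gödel code of $\phi$; dotted symbols $\dot\neg,\dot\wedge,\dot\forall$ denote the corresponding syntactic operations on codes. $\mathrm{Var}$ is the set of (coded) variables; for a set $a$ (or a structure with domain $a$), $\mathrm{VA}^a$ is the set of all functions $\mathrm{Var}\to a$ (variable assignments); for $f\in\mathrm{VA}^a$ and a variable $u$, $\mathrm{VA}^a_{f,u}$ is the set of $g\in\mathrm{VA}^a$ agreeing with $f$ on all variables other than $u$. Intended reading: $\mathsf{Uni}(\mathcal U)$ says that $\mathcal U$ is a universe; $\mathsf{Mod}(\mathcal U,\phi,f)$ says that $\phi$ is true in $\mathcal U$ under $f$. **Abbreviations.** $\mathsf{Mod}(\mathcal U,\phi)$ is $\forall f\in\mathrm{VA}^{\mathcal U}\,\mathsf{Mod}(\mathcal U,\phi,f)$; $\mathsf{Tr}^\Box(\phi)$ is $\forall\mathcal U\,(\mathsf{Uni}(\mathcal U)\rightarrow\mathsf{Mod}(\mathcal U,\phi))$. **The system $\mathsf{CM}^-$** has the axioms: $\mathsf{ZF}$ with Separation and Replacement schemas for all $\mathcal{L}_{\mathsf{Uni},\mathsf{Mod}}$-formulas;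 and, for all $\mathcal U$ with $\mathsf{Uni}(\mathcal U)$, all (codes of) formulas $\phi,\psi\in\mathcal{L}_{\mathsf{Uni},\mathsf{Mod}}$, variables $x,y,u$ and all $f\in\mathrm{VA}^{\mathcal U}$: - $\mathsf{Mod}(\mathcal U,\ulcorner x=y\urcorner,f)\leftrightarrow f(x)=f(y)$; - $\mathsf{Mod}(\mathcal U,\dot\neg\phi,f)\leftrightarrow\neg\mathsf{Mod}(\mathcal U,\phi,f)$; - $\mathsf{Mod}(\mathcal U,\phi\,\dot\wedge\,\psi,f)\leftrightarrow(\mathsf{Mod}(\mathcal U,\phi,f)\wedge\mathsf{Mod}(\mathcal U,\psi,f))$; - $\mathsf{Mod}(\mathcal U,\dot\forall u\,\phi,f)\leftrightarrow\forall g\in\mathrm{VA}^{\mathcal U}_{f,u}\,\mathsf{Mod}(\mathcal U,\phi,g)$. (Str) Universes are treated as structures: every $\mathcal U$ with $\mathsf{Uni}(\mathcal U)$ is a structure, with non-empty domain, for a language including $\mathcal{L}$; for atomic $\phi\in\mathcal{L}$, $\mathsf{Mod}(\mathcal U,\phi,f)$ holds iff $\phi$ is true in the structure $\mathcal U$ under $f$; and for atomic formulas built from $\mathsf{Uni}$ or $\mathsf{Mod}$, $\mathsf{Mod}(\mathcal U,\cdot,f)$ depends only on the values under $f$ of the argument terms. So each universe is an $\mathcal{L}_{\mathsf{Uni},\mathsf{Mod}}$-structure with satisfaction relation given by $\mathsf{Mod}$. **Rule and axiom.** $\mathsf{NEC}$ is the deductive rule: for each sentence $\phi$ of $\mathcal{L}_{\mathsf{Uni},\mathsf{Mod}}$,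 if $\phi$ is provable in the system, then $\mathsf{Tr}^\Box(\ulcorner\phi\urcorner)$ is provable in the system. When axioms are added to a system with deductive rules, the rules may be applied to theorems whose proofs use the added axioms. $\textsf{Non-Triviality}$ is the axiom $\exists\mathcal U\,\mathsf{Uni}(\mathcal U)$. *)

theory Defs
  imports Main
begin

section \<open>Syntax of the language with \<open>Uni\<close> and \<open>Mod\<close>\<close>

text \<open>
  The arithmetical symbols of \<open>\<L>\<close> are \<open>Zero\<close>, \<open>Succ\<close>, \<open>Plus\<close>, \<open>Times\<close>; its symbols for syntactic
  operations on codes are \<open>DNeg\<close>, \<open>DConj\<close>, \<open>DAll\<close> (the dotted connectives) and \<open>Numl\<close>, which sends
  a number \<open>n\<close> to the code of the \<open>n\<close>-th numeral. The pure \<open>\<L>\<close>-formulas are those without \<open>Uni\<close>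
  and \<open>Mod\<close>; both languages have the same terms.
\<close>

datatype tm =
    Var nat
  | Zero
  | Succ tm
  | Plus tm tm
  | Times tm tm
  | DNeg tm
  | DConj tm tm
  | DAll tm tm
  | Numl tm

datatype fm =
    Eq tm tm  (infix "\<^bold>=" 60)
  | Mem tm tm  (infix "\<^bold>\<in>" 60)
  | Uni tm
  | Mod tm tm tm
  | Neg fm  ("\<^bold>\<not> _" [58] 58)
  | Conj fm fm  (infixr "\<^bold>\<and>" 55)
  | Forall nat fm  ("(\<^bold>\<forall>_./ _)" [0, 50] 50)

abbreviation Disj :: "fm \<Rightarrow> fm \<Rightarrow> fm"  (infixr "\<^bold>\<or>" 54) where
  "p \<^bold>\<or> q \<equiv> \<^bold>\<not> (\<^bold>\<not> p \<^bold>\<and> \<^bold>\<not> q)"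

abbreviation Imp :: "fm \<Rightarrow> fm \<Rightarrow> fm"  (infixr "\<^bold>\<longrightarrow>" 53) where
  "p \<^bold>\<longrightarrow> q \<equiv> \<^bold>\<not> (p \<^bold>\<and> \<^bold>\<not> q)"

abbreviation Iff :: "fm \<Rightarrow> fm \<Rightarrow> fm"  (infix "\<^bold>\<longleftrightarrow>" 52) where
  "p \<^bold>\<longleftrightarrow> q \<equiv> (p \<^bold>\<longrightarrow> q) \<^bold>\<and> (q \<^bold>\<longrightarrow> p)"

abbreviation Exists :: "nat \<Rightarrow> fm \<Rightarrow> fm"  ("(\<^bold>\<exists>_./ _)" [0, 50] 50) where
  "\<^bold>\<exists>x. p \<equiv> \<^bold>\<not> (\<^bold>\<forall>x. \<^bold>\<not> p)"

fun conjs :: "fm list \<Rightarrow> fm" where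
  "conjs [] = (Zero \<^bold>= Zero)"
| "conjs (p # ps) = (p \<^bold>\<and> conjs ps)"

primrec tvars :: "tm \<Rightarrow> nat set" where
  "tvars (Var n) = {n}"
| "tvars Zero = {}"
| "tvars (Succ t) = tvars t"
| "tvars (Plus s t) = tvars s \<union> tvars t"
| "tvars (Times s t) = tvars s \<union> tvars t"
| "tvars (DNeg t) = tvars t"
| "tvars (DConj s t) = tvars s \<union> tvars t"
| "tvars (DAll s t) = tvars s \<union> tvars t"
| "tvars (Numl t) = tvars t"

primrec fv :: "fm \<Rightarrow> nat set" where
  "fv (s \<^bold>= t) = tvars s \<union> tvars t"
| "fv (s \<^bold>\<in> t) = tvars s \<union> tvars t"
| "fv (Uni t) = tvars t"
| "fv (Mod r s t) = tvars r \<union> tvars s \<union> tvars t"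
| "fv (\<^bold>\<not> p) = fv p"
| "fv (p \<^bold>\<and> q) = fv p \<union> fv q"
| "fv (\<^bold>\<forall>x. p) = fv p - {x}"

definition sentence :: "fm \<Rightarrow> bool" where
  "sentence p \<longleftrightarrow> fv p = {}"

primrec tsubst :: "nat \<Rightarrow> tm \<Rightarrow> tm \<Rightarrow> tm" where
  "tsubst x u (Var n) = (if n = x then u else Var n)"
| "tsubst x u Zero = Zero"
| "tsubst x u (Succ t) = Succ (tsubst x u t)"
| "tsubst x u (Plus s t) = Plus (tsubst x u s) (tsubst x u t)"
| "tsubst x u (Times s t) = Times (tsubst x u s) (tsubst x u t)"
| "tsubst x u (DNeg t) = DNeg (tsubst x u t)"
| "tsubst x u (DConj s t) = DConj (tsubst x u s) (tsubst x u t)"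
| "tsubst x u (DAll s t) = DAll (tsubst x u s) (tsubst x u t)"
| "tsubst x u (Numl t) = Numl (tsubst x u t)"

text \<open>Substitution for the free occurrences of \<open>x\<close>; it does not rename bound variables, hence the
  side condition \<open>free_for\<close> wherever it is used.\<close>

primrec subst :: "nat \<Rightarrow> tm \<Rightarrow> fm \<Rightarrow> fm" where
  "subst x u (s \<^bold>= t) = (tsubst x u s \<^bold>= tsubst x u t)"
| "subst x u (s \<^bold>\<in> t) = (tsubst x u s \<^bold>\<in> tsubst x u t)"
| "subst x u (Uni t) = Uni (tsubst x u t)"
| "subst x u (Mod r s t) = Mod (tsubst x u r) (tsubst x u s) (tsubst x u t)"
| "subst x u (\<^bold>\<not> p) = (\<^bold>\<not> (subst x u p))"
| "subst x u (p \<^bold>\<and> q) = (subst x u p \<^bold>\<and> subst x u q)"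
| "subst x u (\<^bold>\<forall>y. p) = (\<^bold>\<forall>y. (if y = x then p else subst x u p))"

primrec free_for :: "nat \<Rightarrow> tm \<Rightarrow> fm \<Rightarrow> bool" where
  "free_for x u (s \<^bold>= t) = True"
| "free_for x u (s \<^bold>\<in> t) = True"
| "free_for x u (Uni t) = True"
| "free_for x u (Mod r s t) = True"
| "free_for x u (\<^bold>\<not> p) = free_for x u p"
| "free_for x u (p \<^bold>\<and> q) = (free_for x u p \<and> free_for x u q)"
| "free_for x u (\<^bold>\<forall>y. p) = (x \<notin> fv (\<^bold>\<forall>y. p) \<or> (y \<notin> tvars u \<and> free_for x u p))"


section \<open>Goedel codes\<close>

text \<open>Codes are natural numbers. The pairing \<open>npair x y = (x + y)\<^sup>2 + x\<close> is injective on the natural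
  numbers and is itself given by an arithmetical term, \<open>cpair\<close>.\<close>

definition npair :: "nat \<Rightarrow> nat \<Rightarrow> nat" where
  "npair x y = (x + y) * (x + y) + x"

definition cpair :: "tm \<Rightarrow> tm \<Rightarrow> tm" where
  "cpair s t = Plus (Times (Plus s t) (Plus s t)) s"

primrec nm :: "nat \<Rightarrow> tm" where
  "nm 0 = Zero"
| "nm (Suc n) = Succ (nm n)"

abbreviation (input) "tagVar \<equiv> 0 :: nat"
abbreviation (input) "tagZero \<equiv> 1 :: nat"
abbreviation (input) "tagSucc \<equiv> 2 :: nat"
abbreviation (input) "tagPlus \<equiv> 3 :: nat"
abbreviation (input) "tagTimes \<equiv> 4 :: nat"
abbreviation (input) "tagDNeg \<equiv> 5 :: nat"
abbreviation (input) "tagDConj \<equiv> 6 :: nat"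
abbreviation (input) "tagDAll \<equiv> 7 :: nat"
abbreviation (input) "tagNuml \<equiv> 8 :: nat"
abbreviation (input) "tagEq \<equiv> 9 :: nat"
abbreviation (input) "tagMem \<equiv> 10 :: nat"
abbreviation (input) "tagUni \<equiv> 11 :: nat"
abbreviation (input) "tagMod \<equiv> 12 :: nat"
abbreviation (input) "tagNeg \<equiv> 13 :: nat"
abbreviation (input) "tagConj \<equiv> 14 :: nat"
abbreviation (input) "tagForall \<equiv> 15 :: nat"

primrec gnt :: "tm \<Rightarrow> nat" where
  "gnt (Var n) = npair tagVar n"
| "gnt Zero = npair tagZero 0"
| "gnt (Succ t) = npair tagSucc (gnt t)"
| "gnt (Plus s t) = npair tagPlus (npair (gnt s) (gnt t))"
| "gnt (Times s t) = npair tagTimes (npair (gnt s) (gnt t))"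
| "gnt (DNeg t) = npair tagDNeg (gnt t)"
| "gnt (DConj s t) = npair tagDConj (npair (gnt s) (gnt t))"
| "gnt (DAll s t) = npair tagDAll (npair (gnt s) (gnt t))"
| "gnt (Numl t) = npair tagNuml (gnt t)"

primrec gn :: "fm \<Rightarrow> nat" where
  "gn (s \<^bold>= t) = npair tagEq (npair (gnt s) (gnt t))"
| "gn (s \<^bold>\<in> t) = npair tagMem (npair (gnt s) (gnt t))"
| "gn (Uni t) = npair tagUni (gnt t)"
| "gn (Mod r s t) = npair tagMod (npair (gnt r) (npair (gnt s) (gnt t)))"
| "gn (\<^bold>\<not> p) = npair tagNeg (gn p)"
| "gn (p \<^bold>\<and> q) = npair tagConj (npair (gn p) (gn q))"
| "gn (\<^bold>\<forall>x. p) = npair tagForall (npair (gnt (Var x)) (gn p))"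

definition quote :: "fm \<Rightarrow> tm"  ("\<lceil>_\<rceil>") where
  "\<lceil>p\<rceil> = nm (gn p)"

text \<open>Codes of atomic formulas, as terms in the codes of their argument terms.\<close>

abbreviation (input) "cEq s t \<equiv> cpair (nm tagEq) (cpair s t)"
abbreviation (input) "cMem s t \<equiv> cpair (nm tagMem) (cpair s t)"
abbreviation (input) "cUni t \<equiv> cpair (nm tagUni) t"
abbreviation (input) "cMod r s t \<equiv> cpair (nm tagMod) (cpair r (cpair s t))"


section \<open>Set-theoretic notions expressed in the object language\<close>

text \<open>In each definition the bound variables are chosen above all variables of the arguments, so
  that arbitrary terms may be supplied without capture.\<close>

primrec above :: "tm \<Rightarrow> nat" where
  "above (Var n) = Suc n"
| "above Zero = 0"
| "above (Succ t) = above t"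
| "above (Plus s t) = max (above s) (above t)"
| "above (Times s t) = max (above s) (above t)"
| "above (DNeg t) = above t"
| "above (DConj s t) = max (above s) (above t)"
| "above (DAll s t) = max (above s) (above t)"
| "above (Numl t) = above t"

fun fresh :: "tm list \<Rightarrow> nat" where
  "fresh [] = 0"
| "fresh (t # ts) = max (above t) (fresh ts)"

definition is_upair :: "tm \<Rightarrow> tm \<Rightarrow> tm \<Rightarrow> fm" where  \<comment> \<open>\<open>p = {a, b}\<close>\<close>
  "is_upair p a b = (let w = fresh [p, a, b] in
     \<^bold>\<forall>w. (Var w \<^bold>\<in> p \<^bold>\<longleftrightarrow> (Var w \<^bold>= a \<^bold>\<or> Var w \<^bold>= b)))"

definition is_pair :: "tm \<Rightarrow> tm \<Rightarrow> tm \<Rightarrow> fm" where  \<comment> \<open>\<open>p = {{a}, {a, b}}\<close>\<close>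
  "is_pair p a b = (let s = fresh [p, a, b]; t = s + 1 in
     \<^bold>\<exists>s. \<^bold>\<exists>t. is_upair (Var s) a a \<^bold>\<and> is_upair (Var t) a b \<^bold>\<and> is_upair p (Var s) (Var t))"

definition pair_in :: "tm \<Rightarrow> tm \<Rightarrow> tm \<Rightarrow> fm" where  \<comment> \<open>\<open>\<langle>a, b\<rangle> \<in> F\<close>\<close>
  "pair_in a b F = (let p = fresh [a, b, F] in
     \<^bold>\<exists>p. is_pair (Var p) a b \<^bold>\<and> Var p \<^bold>\<in> F)"

definition pair_pair_in :: "tm \<Rightarrow> tm \<Rightarrow> tm \<Rightarrow> tm \<Rightarrow> fm" where  \<comment> \<open>\<open>\<langle>\<langle>a, b\<rangle>, c\<rangle> \<in> F\<close>\<close>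
  "pair_pair_in a b c F = (let p = fresh [a, b, c, F] in
     \<^bold>\<exists>p. is_pair (Var p) a b \<^bold>\<and> pair_in (Var p) c F)"

definition is_prod :: "tm \<Rightarrow> tm \<Rightarrow> tm \<Rightarrow> fm" where  \<comment> \<open>\<open>P = A \<times> B\<close>\<close>
  "is_prod P A B = (let p = fresh [P, A, B]; a = p + 1; b = p + 2 in
     \<^bold>\<forall>p. (Var p \<^bold>\<in> P \<^bold>\<longleftrightarrow>
       (\<^bold>\<exists>a. \<^bold>\<exists>b. Var a \<^bold>\<in> A \<^bold>\<and> Var b \<^bold>\<in> B \<^bold>\<and> is_pair (Var p) (Var a) (Var b))))"

definition is_fun :: "tm \<Rightarrow> tm \<Rightarrow> tm \<Rightarrow> fm" where  \<comment> \<open>\<open>F : A \<rightarrow> B\<close>\<close>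
  "is_fun F A B = (let p = fresh [F, A, B]; a = p + 1; b = p + 2; c = p + 3 in
     (\<^bold>\<forall>p. (Var p \<^bold>\<in> F \<^bold>\<longrightarrow>
       (\<^bold>\<exists>a. \<^bold>\<exists>b. Var a \<^bold>\<in> A \<^bold>\<and> Var b \<^bold>\<in> B \<^bold>\<and> is_pair (Var p) (Var a) (Var b)))) \<^bold>\<and>
     (\<^bold>\<forall>a. (Var a \<^bold>\<in> A \<^bold>\<longrightarrow>
       (\<^bold>\<exists>b. pair_in (Var a) (Var b) F \<^bold>\<and>
         (\<^bold>\<forall>c. (pair_in (Var a) (Var c) F \<^bold>\<longrightarrow> Var c \<^bold>= Var b))))))"

definition is_nat :: "tm \<Rightarrow> fm" where
  "is_nat n = (let X = fresh [n]; y = X + 1 in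
     \<^bold>\<forall>X. ((Zero \<^bold>\<in> Var X \<^bold>\<and> (\<^bold>\<forall>y. (Var y \<^bold>\<in> Var X \<^bold>\<longrightarrow> Succ (Var y) \<^bold>\<in> Var X))) \<^bold>\<longrightarrow>
       n \<^bold>\<in> Var X))"

definition is_var :: "tm \<Rightarrow> fm" where  \<comment> \<open>\<open>v\<close> is the code of a variable\<close>
  "is_var v = (let n = fresh [v] in
     \<^bold>\<exists>n. is_nat (Var n) \<^bold>\<and> v \<^bold>= cpair (nm tagVar) (Var n))"

definition is_term :: "tm \<Rightarrow> fm" where  \<comment> \<open>\<open>t\<close> is the code of a term\<close>
  "is_term t = (let X = fresh [t]; r = X + 1; s = X + 2 in
     \<^bold>\<forall>X. (conjs
       ([\<^bold>\<forall>r. (is_var (Var r) \<^bold>\<longrightarrow> Var r \<^bold>\<in> Var X),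
         nm (gnt Zero) \<^bold>\<in> Var X] @
        map (\<lambda>k. \<^bold>\<forall>r. (Var r \<^bold>\<in> Var X \<^bold>\<longrightarrow> cpair (nm k) (Var r) \<^bold>\<in> Var X))
          [tagSucc, tagDNeg, tagNuml] @
        map (\<lambda>k. \<^bold>\<forall>r. \<^bold>\<forall>s. ((Var r \<^bold>\<in> Var X \<^bold>\<and> Var s \<^bold>\<in> Var X) \<^bold>\<longrightarrow>
                   cpair (nm k) (cpair (Var r) (Var s)) \<^bold>\<in> Var X))
          [tagPlus, tagTimes, tagDConj, tagDAll])
       \<^bold>\<longrightarrow> t \<^bold>\<in> Var X))"

definition is_form :: "tm \<Rightarrow> fm" where  \<comment> \<open>\<open>p\<close> is the code of a formula of the full language\<close>
  "is_form p = (let X = fresh [p]; r = X + 1; s = X + 2; t = X + 3 in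
     \<^bold>\<forall>X. (conjs
       [\<^bold>\<forall>r. \<^bold>\<forall>s. ((is_term (Var r) \<^bold>\<and> is_term (Var s)) \<^bold>\<longrightarrow> cEq (Var r) (Var s) \<^bold>\<in> Var X),
        \<^bold>\<forall>r. \<^bold>\<forall>s. ((is_term (Var r) \<^bold>\<and> is_term (Var s)) \<^bold>\<longrightarrow> cMem (Var r) (Var s) \<^bold>\<in> Var X),
        \<^bold>\<forall>r. (is_term (Var r) \<^bold>\<longrightarrow> cUni (Var r) \<^bold>\<in> Var X),
        \<^bold>\<forall>r. \<^bold>\<forall>s. \<^bold>\<forall>t. ((is_term (Var r) \<^bold>\<and> is_term (Var s) \<^bold>\<and> is_term (Var t)) \<^bold>\<longrightarrow>
           cMod (Var r) (Var s) (Var t) \<^bold>\<in> Var X),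
        \<^bold>\<forall>r. (Var r \<^bold>\<in> Var X \<^bold>\<longrightarrow> DNeg (Var r) \<^bold>\<in> Var X),
        \<^bold>\<forall>r. \<^bold>\<forall>s. ((Var r \<^bold>\<in> Var X \<^bold>\<and> Var s \<^bold>\<in> Var X) \<^bold>\<longrightarrow> DConj (Var r) (Var s) \<^bold>\<in> Var X),
        \<^bold>\<forall>r. \<^bold>\<forall>s. ((is_var (Var r) \<^bold>\<and> Var s \<^bold>\<in> Var X) \<^bold>\<longrightarrow> DAll (Var r) (Var s) \<^bold>\<in> Var X)]
       \<^bold>\<longrightarrow> p \<^bold>\<in> Var X))"


subsection \<open>Structures, assignments, term evaluation\<close>

text \<open>A structure is a pair \<open>U = \<langle>D, I\<rangle>\<close> of a non-empty domain and a function \<open>I\<close> that sends (the tag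
  of) each symbol of its language to the interpretation of that symbol. \<open>I\<close> may be defined on
  further symbols.\<close>

definition is_structure :: "tm \<Rightarrow> fm" where
  "is_structure U = (let D = fresh [U]; I = D + 1; a = D + 2; b = D + 3; c = D + 4; F = D + 5; P = D + 6 in
     \<^bold>\<exists>D. \<^bold>\<exists>I. conjs
       ([is_pair U (Var D) (Var I),
         \<^bold>\<exists>a. Var a \<^bold>\<in> Var D,
         \<^bold>\<forall>a. (Var a \<^bold>\<in> Var I \<^bold>\<longrightarrow> (\<^bold>\<exists>b. \<^bold>\<exists>c. is_pair (Var a) (Var b) (Var c))),
         \<^bold>\<forall>a. \<^bold>\<forall>b. \<^bold>\<forall>c. ((pair_in (Var a) (Var b) (Var I) \<^bold>\<and> pair_in (Var a) (Var c) (Var I)) \<^bold>\<longrightarrow>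
            Var b \<^bold>= Var c),
         \<^bold>\<exists>F. pair_in (nm tagMem) (Var F) (Var I) \<^bold>\<and>
            (\<^bold>\<forall>a. (Var a \<^bold>\<in> Var F \<^bold>\<longrightarrow>
              (\<^bold>\<exists>b. \<^bold>\<exists>c. Var b \<^bold>\<in> Var D \<^bold>\<and> Var c \<^bold>\<in> Var D \<^bold>\<and> is_pair (Var a) (Var b) (Var c)))),
         \<^bold>\<exists>c. Var c \<^bold>\<in> Var D \<^bold>\<and> pair_in (nm tagZero) (Var c) (Var I)] @
        map (\<lambda>k. \<^bold>\<exists>F. pair_in (nm k) (Var F) (Var I) \<^bold>\<and> is_fun (Var F) (Var D) (Var D))
          [tagSucc, tagDNeg, tagNuml] @
        map (\<lambda>k. \<^bold>\<exists>F. \<^bold>\<exists>P. pair_in (nm k) (Var F) (Var I) \<^bold>\<and>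
                   is_prod (Var P) (Var D) (Var D) \<^bold>\<and> is_fun (Var F) (Var P) (Var D))
          [tagPlus, tagTimes, tagDConj, tagDAll]))"

definition interp :: "tm \<Rightarrow> nat \<Rightarrow> tm \<Rightarrow> fm" where  \<comment> \<open>\<open>F\<close> interprets the symbol with tag \<open>k\<close> in \<open>U\<close>\<close>
  "interp U k F = (let D = fresh [U, F]; I = D + 1 in
     \<^bold>\<exists>D. \<^bold>\<exists>I. is_pair U (Var D) (Var I) \<^bold>\<and> pair_in (nm k) F (Var I))"

definition is_VA :: "tm \<Rightarrow> tm \<Rightarrow> fm" where  \<comment> \<open>\<open>f \<in> VA\<^sup>U\<close>, i.e. \<open>f\<close> maps the set of variables to the domain of \<open>U\<close>\<close>
  "is_VA U f = (let D = fresh [U, f]; I = D + 1; V = D + 2; v = D + 3 in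
     \<^bold>\<exists>D. \<^bold>\<exists>I. \<^bold>\<exists>V. is_pair U (Var D) (Var I) \<^bold>\<and>
       (\<^bold>\<forall>v. (Var v \<^bold>\<in> Var V \<^bold>\<longleftrightarrow> is_var (Var v))) \<^bold>\<and> is_fun f (Var V) (Var D))"

definition is_VA_variant :: "tm \<Rightarrow> tm \<Rightarrow> tm \<Rightarrow> tm \<Rightarrow> fm" where  \<comment> \<open>\<open>g \<in> VA\<^sup>U\<close>, and \<open>g\<close> agrees with \<open>f\<close> off \<open>u\<close>\<close>
  "is_VA_variant U f u g = (let v = fresh [U, f, u, g]; d = v + 1 in
     is_VA U g \<^bold>\<and>
     (\<^bold>\<forall>v. ((is_var (Var v) \<^bold>\<and> \<^bold>\<not> Var v \<^bold>= u) \<^bold>\<longrightarrow>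
       (\<^bold>\<forall>d. (pair_in (Var v) (Var d) g \<^bold>\<longleftrightarrow> pair_in (Var v) (Var d) f)))))"

text \<open>\<open>is_val U f t d\<close>: the term with code \<open>t\<close> has value \<open>d\<close> in \<open>U\<close> under \<open>f\<close>; the graph of the
  evaluation function is the least set closed under the Tarskian clauses.\<close>

definition is_val :: "tm \<Rightarrow> tm \<Rightarrow> tm \<Rightarrow> tm \<Rightarrow> fm" where
  "is_val U f t d = (let X = fresh [U, f, t, d]; r = X + 1; s = X + 2; a = X + 3; b = X + 4; c = X + 5; F = X + 6 in
     \<^bold>\<forall>X. (conjs
       ([\<^bold>\<forall>r. \<^bold>\<forall>a. (pair_in (Var r) (Var a) f \<^bold>\<longrightarrow> pair_in (Var r) (Var a) (Var X)),
         \<^bold>\<forall>c. (interp U tagZero (Var c) \<^bold>\<longrightarrow> pair_in (nm (gnt Zero)) (Var c) (Var X))] @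
        map (\<lambda>k. \<^bold>\<forall>r. \<^bold>\<forall>a. \<^bold>\<forall>b. \<^bold>\<forall>F. ((interp U k (Var F) \<^bold>\<and>
                   pair_in (Var r) (Var a) (Var X) \<^bold>\<and> pair_in (Var a) (Var b) (Var F)) \<^bold>\<longrightarrow>
                   pair_in (cpair (nm k) (Var r)) (Var b) (Var X)))
          [tagSucc, tagDNeg, tagNuml] @
        map (\<lambda>k. \<^bold>\<forall>r. \<^bold>\<forall>s. \<^bold>\<forall>a. \<^bold>\<forall>b. \<^bold>\<forall>c. \<^bold>\<forall>F. ((interp U k (Var F) \<^bold>\<and>
                   pair_in (Var r) (Var a) (Var X) \<^bold>\<and> pair_in (Var s) (Var b) (Var X) \<^bold>\<and>
                   pair_pair_in (Var a) (Var b) (Var c) (Var F)) \<^bold>\<longrightarrow>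
                   pair_in (cpair (nm k) (cpair (Var r) (Var s))) (Var c) (Var X)))
          [tagPlus, tagTimes, tagDConj, tagDAll])
       \<^bold>\<longrightarrow> pair_in t d (Var X)))"

definition same_val :: "tm \<Rightarrow> tm \<Rightarrow> tm \<Rightarrow> tm \<Rightarrow> tm \<Rightarrow> fm" where
  "same_val U f s g t = (let d = fresh [U, f, s, g, t] in
     \<^bold>\<exists>d. is_val U f s (Var d) \<^bold>\<and> is_val U g t (Var d))"

definition Mod_all :: "tm \<Rightarrow> tm \<Rightarrow> fm" where  \<comment> \<open>truth in \<open>U\<close> under all assignments\<close>
  "Mod_all U p = (let f = fresh [U, p] in
     \<^bold>\<forall>f. (is_VA U (Var f) \<^bold>\<longrightarrow> Mod U p (Var f)))"

definition TrBox :: "tm \<Rightarrow> fm" where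
  "TrBox p = (let U = fresh [p] in
     \<^bold>\<forall>U. (Uni (Var U) \<^bold>\<longrightarrow> Mod_all (Var U) p))"


section \<open>Axioms\<close>

text \<open>Free variables of axioms are read universally, as the rule \<open>AllI\<close> below permits.\<close>

definition ZF_finite :: "fm set" where
  "ZF_finite = (let x = 0; y = 1; z = 2; A = 3; B = 4 in
   { \<comment> \<open>Extensionality\<close>
     (\<^bold>\<forall>z. (Var z \<^bold>\<in> Var x \<^bold>\<longleftrightarrow> Var z \<^bold>\<in> Var y)) \<^bold>\<longrightarrow> Var x \<^bold>= Var y,
     \<comment> \<open>Foundation\<close>
     (\<^bold>\<exists>y. Var y \<^bold>\<in> Var x) \<^bold>\<longrightarrow>
       (\<^bold>\<exists>y. Var y \<^bold>\<in> Var x \<^bold>\<and> \<^bold>\<not> (\<^bold>\<exists>z. Var z \<^bold>\<in> Var x \<^bold>\<and> Var z \<^bold>\<in> Var y)),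
     \<comment> \<open>Pairing\<close>
     \<^bold>\<exists>A. is_upair (Var A) (Var x) (Var y),
     \<comment> \<open>Union\<close>
     \<^bold>\<exists>B. \<^bold>\<forall>x. (Var x \<^bold>\<in> Var B \<^bold>\<longleftrightarrow> (\<^bold>\<exists>y. Var x \<^bold>\<in> Var y \<^bold>\<and> Var y \<^bold>\<in> Var A)),
     \<comment> \<open>Power set\<close>
     \<^bold>\<exists>B. \<^bold>\<forall>x. (Var x \<^bold>\<in> Var B \<^bold>\<longleftrightarrow> (\<^bold>\<forall>z. (Var z \<^bold>\<in> Var x \<^bold>\<longrightarrow> Var z \<^bold>\<in> Var A))),
     \<comment> \<open>Infinity\<close>
     \<^bold>\<exists>A. Zero \<^bold>\<in> Var A \<^bold>\<and> (\<^bold>\<forall>x. (Var x \<^bold>\<in> Var A \<^bold>\<longrightarrow> Succ (Var x) \<^bold>\<in> Var A)) })"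

definition Separation :: "fm set" where
  "Separation = {\<^bold>\<exists>B. \<^bold>\<forall>x. (Var x \<^bold>\<in> Var B \<^bold>\<longleftrightarrow> (Var x \<^bold>\<in> Var A \<^bold>\<and> p)) | p x A B.
     distinct [x, A, B] \<and> B \<notin> fv p}"

definition Replacement :: "fm set" where
  "Replacement =
     {(\<^bold>\<forall>x. (Var x \<^bold>\<in> Var A \<^bold>\<longrightarrow> (\<^bold>\<exists>z. \<^bold>\<forall>y. (p \<^bold>\<longrightarrow> Var y \<^bold>= Var z)))) \<^bold>\<longrightarrow>
        (\<^bold>\<exists>B. \<^bold>\<forall>y. (Var y \<^bold>\<in> Var B \<^bold>\<longleftrightarrow> (\<^bold>\<exists>x. Var x \<^bold>\<in> Var A \<^bold>\<and> p))) | p x y z A B.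
      distinct [x, y, z, A, B] \<and> z \<notin> fv p \<and> B \<notin> fv p}"

text \<open>Defining axioms of the function symbols. The arithmetical operations and \<open>Numl\<close> are given by
  their recursion equations on the natural numbers and take the value \<open>0\<close> elsewhere.\<close>

definition symbol_axioms :: "fm set" where
  "symbol_axioms = (let x = 0; y = 1; z = 2 in
   { \<^bold>\<not> Var x \<^bold>\<in> Zero,
     Var z \<^bold>\<in> Succ (Var x) \<^bold>\<longleftrightarrow> (Var z \<^bold>\<in> Var x \<^bold>\<or> Var z \<^bold>= Var x),
     is_nat (Var x) \<^bold>\<longrightarrow> Plus (Var x) Zero \<^bold>= Var x,
     (is_nat (Var x) \<^bold>\<and> is_nat (Var y)) \<^bold>\<longrightarrow>
        Plus (Var x) (Succ (Var y)) \<^bold>= Succ (Plus (Var x) (Var y)),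
     \<^bold>\<not> (is_nat (Var x) \<^bold>\<and> is_nat (Var y)) \<^bold>\<longrightarrow> Plus (Var x) (Var y) \<^bold>= Zero,
     is_nat (Var x) \<^bold>\<longrightarrow> Times (Var x) Zero \<^bold>= Zero,
     (is_nat (Var x) \<^bold>\<and> is_nat (Var y)) \<^bold>\<longrightarrow>
        Times (Var x) (Succ (Var y)) \<^bold>= Plus (Times (Var x) (Var y)) (Var x),
     \<^bold>\<not> (is_nat (Var x) \<^bold>\<and> is_nat (Var y)) \<^bold>\<longrightarrow> Times (Var x) (Var y) \<^bold>= Zero,
     DNeg (Var x) \<^bold>= cpair (nm tagNeg) (Var x),
     DConj (Var x) (Var y) \<^bold>= cpair (nm tagConj) (cpair (Var x) (Var y)),
     DAll (Var x) (Var y) \<^bold>= cpair (nm tagForall) (cpair (Var x) (Var y)),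
     Numl Zero \<^bold>= nm (gnt Zero),
     is_nat (Var x) \<^bold>\<longrightarrow> Numl (Succ (Var x)) \<^bold>= cpair (nm tagSucc) (Numl (Var x)),
     \<^bold>\<not> is_nat (Var x) \<^bold>\<longrightarrow> Numl (Var x) \<^bold>= Zero })"

definition ZF :: "fm set" where
  "ZF = ZF_finite \<union> Separation \<union> Replacement \<union> symbol_axioms"

definition Mod_axioms :: "fm set" where
  "Mod_axioms = (let U = 0; p = 1; q = 2; x = 3; y = 4; u = 5; f = 6; g = 7; d = 8 in
   { (Uni (Var U) \<^bold>\<and> is_var (Var x) \<^bold>\<and> is_var (Var y) \<^bold>\<and> is_VA (Var U) (Var f)) \<^bold>\<longrightarrow>
       (Mod (Var U) (cEq (Var x) (Var y)) (Var f) \<^bold>\<longleftrightarrow>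
         (\<^bold>\<exists>d. pair_in (Var x) (Var d) (Var f) \<^bold>\<and> pair_in (Var y) (Var d) (Var f))),
     (Uni (Var U) \<^bold>\<and> is_form (Var p) \<^bold>\<and> is_VA (Var U) (Var f)) \<^bold>\<longrightarrow>
       (Mod (Var U) (DNeg (Var p)) (Var f) \<^bold>\<longleftrightarrow> \<^bold>\<not> Mod (Var U) (Var p) (Var f)),
     (Uni (Var U) \<^bold>\<and> is_form (Var p) \<^bold>\<and> is_form (Var q) \<^bold>\<and> is_VA (Var U) (Var f)) \<^bold>\<longrightarrow>
       (Mod (Var U) (DConj (Var p) (Var q)) (Var f) \<^bold>\<longleftrightarrow>
         (Mod (Var U) (Var p) (Var f) \<^bold>\<and> Mod (Var U) (Var q) (Var f))),
     (Uni (Var U) \<^bold>\<and> is_form (Var p) \<^bold>\<and> is_var (Var u) \<^bold>\<and> is_VA (Var U) (Var f)) \<^bold>\<longrightarrow>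
       (Mod (Var U) (DAll (Var u) (Var p)) (Var f) \<^bold>\<longleftrightarrow>
         (\<^bold>\<forall>g. (is_VA_variant (Var U) (Var f) (Var u) (Var g) \<^bold>\<longrightarrow>
                Mod (Var U) (Var p) (Var g)))) })"

text \<open>Universes as structures. The last two axioms say that the truth of an atomic formula built
  from \<open>Uni\<close> or \<open>Mod\<close> depends only on the values of the argument terms.\<close>

definition Str :: "fm set" where
  "Str = (let U = 0; f = 1; g = 2; r = 3; s = 4; t = 5; r' = 6; s' = 7; t' = 8; a = 9; b = 10; E = 11 in
   { Uni (Var U) \<^bold>\<longrightarrow> is_structure (Var U),
     (Uni (Var U) \<^bold>\<and> is_term (Var s) \<^bold>\<and> is_term (Var t) \<^bold>\<and> is_VA (Var U) (Var f)) \<^bold>\<longrightarrow>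
       (Mod (Var U) (cEq (Var s) (Var t)) (Var f) \<^bold>\<longleftrightarrow>
         same_val (Var U) (Var f) (Var s) (Var f) (Var t)),
     (Uni (Var U) \<^bold>\<and> is_term (Var s) \<^bold>\<and> is_term (Var t) \<^bold>\<and> is_VA (Var U) (Var f)) \<^bold>\<longrightarrow>
       (Mod (Var U) (cMem (Var s) (Var t)) (Var f) \<^bold>\<longleftrightarrow>
         (\<^bold>\<exists>a. \<^bold>\<exists>b. \<^bold>\<exists>E. is_val (Var U) (Var f) (Var s) (Var a) \<^bold>\<and>
            is_val (Var U) (Var f) (Var t) (Var b) \<^bold>\<and>
            interp (Var U) tagMem (Var E) \<^bold>\<and> pair_in (Var a) (Var b) (Var E))),
     (Uni (Var U) \<^bold>\<and> is_term (Var s) \<^bold>\<and> is_term (Var s') \<^bold>\<and>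
      is_VA (Var U) (Var f) \<^bold>\<and> is_VA (Var U) (Var g) \<^bold>\<and>
      same_val (Var U) (Var f) (Var s) (Var g) (Var s')) \<^bold>\<longrightarrow>
       (Mod (Var U) (cUni (Var s)) (Var f) \<^bold>\<longleftrightarrow> Mod (Var U) (cUni (Var s')) (Var g)),
     (Uni (Var U) \<^bold>\<and> is_term (Var r) \<^bold>\<and> is_term (Var s) \<^bold>\<and> is_term (Var t) \<^bold>\<and>
      is_term (Var r') \<^bold>\<and> is_term (Var s') \<^bold>\<and> is_term (Var t') \<^bold>\<and>
      is_VA (Var U) (Var f) \<^bold>\<and> is_VA (Var U) (Var g) \<^bold>\<and>
      same_val (Var U) (Var f) (Var r) (Var g) (Var r') \<^bold>\<and>
      same_val (Var U) (Var f) (Var s) (Var g) (Var s') \<^bold>\<and>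
      same_val (Var U) (Var f) (Var t) (Var g) (Var t')) \<^bold>\<longrightarrow>
       (Mod (Var U) (cMod (Var r) (Var s) (Var t)) (Var f) \<^bold>\<longleftrightarrow>
        Mod (Var U) (cMod (Var r') (Var s') (Var t')) (Var g)) })"

definition CM_minus :: "fm set" where
  "CM_minus = ZF \<union> Mod_axioms \<union> Str"

definition T_CM :: "fm set" where
  "T_CM = {TrBox \<lceil>p\<rceil> \<^bold>\<longrightarrow> p | p. sentence p}"

definition Four_CM :: "fm set" where
  "Four_CM = {TrBox \<lceil>p\<rceil> \<^bold>\<longrightarrow> TrBox \<lceil>TrBox \<lceil>p\<rceil>\<rceil> | p. sentence p}"

definition Non_Triviality :: fm where
  "Non_Triviality = (\<^bold>\<exists>0. Uni (Var 0))"


section \<open>Provability with the rule NEC\<close>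

text \<open>Classical natural deduction with equality; \<open>\<Gamma>\<close> is the set of open assumptions. The rule \<open>NEC\<close>
  applies to theorems of the system only, that is, to sentences derived from no open assumptions.\<close>

inductive derives_NEC :: "fm set \<Rightarrow> fm set \<Rightarrow> fm \<Rightarrow> bool" for Ax :: "fm set" where
  Axiom: "p \<in> Ax \<Longrightarrow> derives_NEC Ax \<Gamma> p"
| Assm: "p \<in> \<Gamma> \<Longrightarrow> derives_NEC Ax \<Gamma> p"
| NegI: "derives_NEC Ax (insert p \<Gamma>) q \<Longrightarrow> derives_NEC Ax (insert p \<Gamma>) (\<^bold>\<not> q) \<Longrightarrow>
    derives_NEC Ax \<Gamma> (\<^bold>\<not> p)"
| Contr: "derives_NEC Ax (insert (\<^bold>\<not> p) \<Gamma>) q \<Longrightarrow> derives_NEC Ax (insert (\<^bold>\<not> p) \<Gamma>) (\<^bold>\<not> q) \<Longrightarrow>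
    derives_NEC Ax \<Gamma> p"
| ConjI: "derives_NEC Ax \<Gamma> p \<Longrightarrow> derives_NEC Ax \<Gamma> q \<Longrightarrow> derives_NEC Ax \<Gamma> (p \<^bold>\<and> q)"
| ConjE1: "derives_NEC Ax \<Gamma> (p \<^bold>\<and> q) \<Longrightarrow> derives_NEC Ax \<Gamma> p"
| ConjE2: "derives_NEC Ax \<Gamma> (p \<^bold>\<and> q) \<Longrightarrow> derives_NEC Ax \<Gamma> q"
| AllI: "derives_NEC Ax \<Gamma> p \<Longrightarrow> \<forall>q\<in>\<Gamma>. x \<notin> fv q \<Longrightarrow> derives_NEC Ax \<Gamma> (\<^bold>\<forall>x. p)"
| AllE: "derives_NEC Ax \<Gamma> (\<^bold>\<forall>x. p) \<Longrightarrow> free_for x t p \<Longrightarrow> derives_NEC Ax \<Gamma> (subst x t p)"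
| EqRefl: "derives_NEC Ax \<Gamma> (t \<^bold>= t)"
| EqSubst: "derives_NEC Ax \<Gamma> (s \<^bold>= t) \<Longrightarrow> derives_NEC Ax \<Gamma> (subst x s p) \<Longrightarrow>
    free_for x s p \<Longrightarrow> free_for x t p \<Longrightarrow> derives_NEC Ax \<Gamma> (subst x t p)"
| NEC: "derives_NEC Ax {} p \<Longrightarrow> sentence p \<Longrightarrow> derives_NEC Ax \<Gamma> (TrBox \<lceil>p\<rceil>)"

definition provable_NEC :: "fm set \<Rightarrow> fm \<Rightarrow> bool" where
  "provable_NEC Ax p \<longleftrightarrow> derives_NEC Ax {} p"

definition inconsistent_NEC :: "fm set \<Rightarrow> bool" where
  "inconsistent_NEC Ax \<longleftrightarrow> (\<exists>p. provable_NEC Ax p \<and> provable_NEC Ax (\<^bold>\<not> p))"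

end

theory Submission
  imports Defs "HOL-Library.Countable"
begin

text \<open>
  Diagonalization gives a sentence \<open>liar\<close>, say \<open>\<lambda>\<close>, with \<open>\<lambda> \<longleftrightarrow> \<not> Tr \<lambda>\<close> provable, where \<open>Tr\<close> is
  truth in all universes. In both systems \<open>\<not> Tr \<lambda>\<close> is provable, hence so is \<open>\<lambda>\<close>, and \<open>NEC\<close> yields
  \<open>Tr \<lambda>\<close>, a contradiction. For (a), \<open>\<not> Tr \<lambda>\<close> is immediate from \<open>Tr \<lambda> \<longrightarrow> \<lambda>\<close>. For (b), assume \<open>Tr \<lambda>\<close>;
  then \<open>Tr (Tr \<lambda>)\<close> by axiom 4 and \<open>Tr (\<not> (\<lambda> \<and> Tr \<lambda>))\<close> by \<open>NEC\<close>, and by Non-Triviality there are a universe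
  and an assignment into it, where these three truths contradict the clauses for the connectives.

  Provability claims in the object theory are obtained from a completeness theorem: a formula that
  holds in every structure satisfying all theorems is a theorem. (\<open>NEC\<close> is harmless here: its conclusions hold in these
  structures because they are theorems.) The set-theoretic facts are then established inside an
  arbitrary such structure.
\<close>

section \<open>Substitution\<close>

lemma finite_tvars: "finite (tvars t)"
  by (induction t) auto

lemma finite_fv: "finite (fv p)"
  by (induction p) (auto simp: finite_tvars)

text \<open>Bound variables count too: a variable outside \<open>allv p\<close> can replace a free
  variable without capture, and the replacement can be undone.\<close>

primrec allv :: "fm \<Rightarrow> nat set" where
  "allv (s \<^bold>= t) = tvars s \<union> tvars t"
| "allv (s \<^bold>\<in> t) = tvars s \<union> tvars t"
| "allv (Uni t) = tvars t"
| "allv (Mod r s t) = tvars r \<union> tvars s \<union> tvars t"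
| "allv (\<^bold>\<not> p) = allv p"
| "allv (p \<^bold>\<and> q) = allv p \<union> allv q"
| "allv (\<^bold>\<forall>x. p) = insert x (allv p)"

lemma finite_allv: "finite (allv p)"
  by (induction p) (auto simp: finite_tvars)

lemma fv_subset_allv: "fv p \<subseteq> allv p"
  by (induction p) auto

lemma tsubst_fresh: "x \<notin> tvars t \<Longrightarrow> tsubst x u t = t"
  by (induction t) auto

lemma tsubst_self: "tsubst x (Var x) t = t"
  by (induction t) auto

lemma subst_self: "subst x (Var x) p = p"
  by (induction p) (auto simp: tsubst_self)

lemma free_for_self: "free_for x (Var x) p"
  by (induction p) auto

lemma free_for_new: "y \<notin> allv p \<Longrightarrow> free_for x (Var y) p"
  by (induction p) auto

lemma tvars_tsubst_varD: "z \<in> tvars (tsubst x (Var y) t) \<Longrightarrow> z = y \<or> z \<in> tvars t \<and> z \<noteq> x"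
  by (induction t) (auto split: if_splits)

lemma fv_subst_varD: "z \<in> fv (subst x (Var y) p) \<Longrightarrow> z = y \<or> z \<in> fv p \<and> z \<noteq> x"
  by (induction p) (auto dest: tvars_tsubst_varD split: if_splits)

lemma tvars_tsubst_varI: "z \<in> tvars t \<Longrightarrow> z \<noteq> x \<Longrightarrow> z \<in> tvars (tsubst x u t)"
  by (induction t) auto

lemma fv_subst_varI: "z \<in> fv p \<Longrightarrow> z \<noteq> x \<Longrightarrow> z \<in> fv (subst x u p)"
  by (induction p) (auto intro: tvars_tsubst_varI)

lemma tsubst_back: "y \<notin> tvars t \<Longrightarrow> tsubst y (Var x) (tsubst x (Var y) t) = t"
  by (induction t) auto

text \<open>As \<open>y\<close> occurs nowhere in \<open>p\<close>, its occurrences after the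
  renaming are exactly the former free occurrences of \<open>x\<close>.\<close>

lemma subst_back: "y \<notin> allv p \<Longrightarrow> subst y (Var x) (subst x (Var y) p) = p"
proof (induction p)
  case (Forall z p)
  \<comment> \<open>For the case \<open>z = x\<close>: the first substitution skips the body, so the
    second has to leave it unchanged.\<close>
  have "subst y (Var x) p = p" if "y \<notin> allv p" for p
    using that by (induction p) (auto simp: tsubst_fresh)
  with Forall show ?case by auto
qed (auto simp: tsubst_back)

text \<open>Below a quantifier binding \<open>x\<close> no occurrence of \<open>x\<close> was free,
  so none became \<open>y\<close> and none can be captured on the way back.\<close>

lemma free_for_back: "y \<notin> allv p \<Longrightarrow> free_for y (Var x) (subst x (Var y) p)"
proof (induction p)
  case (Forall z p)
  then show ?case using fv_subset_allv by auto
qed auto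


section \<open>Weakening and modus ponens\<close>

text \<open>\<open>E\<close> is meant to contain the eigenvariables of a derivation of \<open>p\<close> from \<open>\<Gamma>\<close>; these are the only
  obstruction to weakening.\<close>

definition avoiding :: "fm set \<Rightarrow> nat set \<Rightarrow> fm set \<Rightarrow> fm \<Rightarrow> bool" where
  "avoiding Ax E \<Gamma> p \<longleftrightarrow> finite E \<and>
     (\<forall>\<Delta>. \<Gamma> \<subseteq> \<Delta> \<longrightarrow> (\<forall>q\<in>\<Delta> - \<Gamma>. fv q \<inter> E = {}) \<longrightarrow> derives_NEC Ax \<Delta> p)"

lemma avoidingI:
  assumes "finite E"
    and "\<And>\<Delta>. \<Gamma> \<subseteq> \<Delta> \<Longrightarrow> \<forall>q\<in>\<Delta> - \<Gamma>. fv q \<inter> E = {} \<Longrightarrow> derives_NEC Ax \<Delta> p"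
  shows "avoiding Ax E \<Gamma> p"
  using assms by (simp add: avoiding_def)

lemma avoidingD:
  assumes "avoiding Ax E \<Gamma> p" "\<Gamma> \<subseteq> \<Delta>" "\<And>q. q \<in> \<Delta> - \<Gamma> \<Longrightarrow> fv q \<inter> E = {}"
  shows "derives_NEC Ax \<Delta> p"
  using assms by (simp add: avoiding_def)

lemma avoiding_finite: "avoiding Ax E \<Gamma> p \<Longrightarrow> finite E"
  by (simp add: avoiding_def)

lemma avoiding_mono: "avoiding Ax E \<Gamma> p \<Longrightarrow> E \<subseteq> F \<Longrightarrow> finite F \<Longrightarrow> avoiding Ax F \<Gamma> p"
  by (rule avoidingI, assumption) (erule avoidingD, auto)

lemma avoiding_join:
  assumes "\<exists>E. avoiding Ax E \<Gamma> p" "\<exists>E. avoiding Ax E \<Delta> q"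
  obtains E where "avoiding Ax E \<Gamma> p" "avoiding Ax E \<Delta> q"
proof -
  obtain E F where EF: "avoiding Ax E \<Gamma> p" "avoiding Ax F \<Delta> q"
    using assms by blast
  then have "finite (E \<union> F)" by (simp add: avoiding_finite)
  with EF show ?thesis
    using avoiding_mono[of Ax E \<Gamma> p "E \<union> F"] avoiding_mono[of Ax F \<Delta> q "E \<union> F"] that by simp
qed

text \<open>Induction on the derivation, collecting eigenvariables: \<open>AllI\<close> adds its
  own, and two premises share a common set. \<open>NEC\<close> restarts from the empty set, since
  its conclusion holds in any context.\<close>

lemma derives_avoiding:
  assumes "derives_NEC Ax \<Gamma> p"
  shows "\<exists>E. avoiding Ax E \<Gamma> p"
  using assms
proof (induction rule: derives_NEC.induct)
  case (Axiom p \<Gamma>)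
  then have "avoiding Ax {} \<Gamma> p" by (simp add: avoiding_def derives_NEC.Axiom)
  then show ?case ..
next
  case (Assm p \<Gamma>)
  then have "avoiding Ax {} \<Gamma> p" by (simp add: avoiding_def derives_NEC.Assm subset_iff)
  then show ?case ..
next
  case (NegI p \<Gamma> q)
  obtain E where E: "avoiding Ax E (insert p \<Gamma>) q" "avoiding Ax E (insert p \<Gamma>) (\<^bold>\<not> q)"
    by (rule avoiding_join[OF NegI.IH])
  have "avoiding Ax E \<Gamma> (\<^bold>\<not> p)"
  proof (rule avoidingI[OF avoiding_finite[OF E(1)]])
    fix \<Delta> assume D: "\<Gamma> \<subseteq> \<Delta>" "\<forall>q\<in>\<Delta> - \<Gamma>. fv q \<inter> E = {}"
    show "derives_NEC Ax \<Delta> (\<^bold>\<not> p)"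
      by (rule derives_NEC.NegI[OF avoidingD[OF E(1)] avoidingD[OF E(2)]]) (use D in auto)
  qed
  then show ?case ..
next
  case (Contr p \<Gamma> q)
  obtain E where E: "avoiding Ax E (insert (\<^bold>\<not> p) \<Gamma>) q" "avoiding Ax E (insert (\<^bold>\<not> p) \<Gamma>) (\<^bold>\<not> q)"
    by (rule avoiding_join[OF Contr.IH])
  have "avoiding Ax E \<Gamma> p"
  proof (rule avoidingI[OF avoiding_finite[OF E(1)]])
    fix \<Delta> assume D: "\<Gamma> \<subseteq> \<Delta>" "\<forall>q\<in>\<Delta> - \<Gamma>. fv q \<inter> E = {}"
    show "derives_NEC Ax \<Delta> p"
      by (rule derives_NEC.Contr[OF avoidingD[OF E(1)] avoidingD[OF E(2)]]) (use D in auto)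
  qed
  then show ?case ..
next
  case (ConjI \<Gamma> p q)
  obtain E where E: "avoiding Ax E \<Gamma> p" "avoiding Ax E \<Gamma> q"
    by (rule avoiding_join[OF ConjI.IH])
  then have "avoiding Ax E \<Gamma> (p \<^bold>\<and> q)"
    by (simp add: avoiding_def derives_NEC.ConjI)
  then show ?case ..
next
  case (ConjE1 \<Gamma> p q)
  then obtain E where E: "avoiding Ax E \<Gamma> (p \<^bold>\<and> q)" by blast
  have "avoiding Ax E \<Gamma> p"
    by (rule avoidingI[OF avoiding_finite[OF E] derives_NEC.ConjE1[OF avoidingD[OF E]]]) auto
  then show ?case ..
next
  case (ConjE2 \<Gamma> p q)
  then obtain E where E: "avoiding Ax E \<Gamma> (p \<^bold>\<and> q)" by blast
  have "avoiding Ax E \<Gamma> q"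
    by (rule avoidingI[OF avoiding_finite[OF E] derives_NEC.ConjE2[OF avoidingD[OF E]]]) auto
  then show ?case ..
next
  case (AllI \<Gamma> p x)
  then obtain E where E: "avoiding Ax E \<Gamma> p" by blast
  have "avoiding Ax (insert x E) \<Gamma> (\<^bold>\<forall>x. p)"
  proof (rule avoidingI)
    fix \<Delta> assume D: "\<Gamma> \<subseteq> \<Delta>" "\<forall>q\<in>\<Delta> - \<Gamma>. fv q \<inter> insert x E = {}"
    show "derives_NEC Ax \<Delta> (\<^bold>\<forall>x. p)"
      by (rule derives_NEC.AllI[OF avoidingD[OF E]]) (use D AllI.hyps(2) in auto)
  qed (use avoiding_finite[OF E] in simp)
  then show ?case ..
next
  case (AllE \<Gamma> x p t)
  then obtain E where E: "avoiding Ax E \<Gamma> (\<^bold>\<forall>x. p)" by blast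
  have "avoiding Ax E \<Gamma> (subst x t p)"
    by (rule avoidingI[OF avoiding_finite[OF E] derives_NEC.AllE[OF avoidingD[OF E] AllE.hyps(2)]]) auto
  then show ?case ..
next
  case (EqRefl \<Gamma> t)
  have "avoiding Ax {} \<Gamma> (t \<^bold>= t)" by (simp add: avoiding_def derives_NEC.EqRefl)
  then show ?case ..
next
  case (EqSubst \<Gamma> s t x p)
  obtain E where E: "avoiding Ax E \<Gamma> (s \<^bold>= t)" "avoiding Ax E \<Gamma> (subst x s p)"
    by (rule avoiding_join[OF EqSubst.IH])
  have "avoiding Ax E \<Gamma> (subst x t p)"
    by (rule avoidingI[OF avoiding_finite[OF E(1)]
          derives_NEC.EqSubst[OF avoidingD[OF E(1)] avoidingD[OF E(2)] EqSubst.hyps(3,4)]]) auto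
  then show ?case ..
next
  case (NEC p \<Gamma>)
  have "avoiding Ax {} \<Gamma> (TrBox \<lceil>p\<rceil>)"
    by (simp add: avoiding_def derives_NEC.NEC[OF NEC.hyps])
  then show ?case ..
qed

text \<open>In a context that avoids \<open>E\<close>, the variable \<open>x\<close> is not free, so
  it may be generalized and instantiated by \<open>y\<close>. The set \<open>E\<close> does not
  grow.\<close>

lemma avoiding_rename:
  assumes "avoiding Ax E {} p" "x \<in> E" "y \<notin> allv p"
  shows "avoiding Ax E {} (subst x (Var y) p)"
proof (rule avoidingI[OF avoiding_finite[OF assms(1)]])
  fix \<Delta> assume D: "{} \<subseteq> \<Delta>" "\<forall>q\<in>\<Delta> - {}. fv q \<inter> E = {}"
  show "derives_NEC Ax \<Delta> (subst x (Var y) p)"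
    by (rule derives_NEC.AllE[OF derives_NEC.AllI[OF avoidingD[OF assms(1) D(1)]] free_for_new[OF assms(3)]])
      (use D assms(2) in auto)
qed

lemma derives_rename_back:
  assumes "derives_NEC Ax {} (subst x (Var y) p)" "y \<notin> allv p"
  shows "derives_NEC Ax {} p"
proof -
  have "derives_NEC Ax {} (subst y (Var x) (subst x (Var y) p))"
    by (rule derives_NEC.AllE[OF derives_NEC.AllI[OF assms(1)] free_for_back[OF assms(2)]]) simp
  with assms(2) show ?thesis by (simp add: subst_back)
qed

text \<open>Cutting \<open>p\<close> requires \<open>\<^bold>\<not> q\<close> as an assumption, whose free variables may be eigenvariables of the
  given derivations; these are first renamed.\<close>

lemma avoiding_mp:
  "avoiding Ax E {} (p \<^bold>\<longrightarrow> q) \<Longrightarrow> avoiding Ax E {} p \<Longrightarrow> derives_NEC Ax {} q"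
\<comment> \<open>The measure counts the free variables of \<open>q\<close> that still block
  weakening; each renaming to a variable outside \<open>E\<close> removes one.\<close>
proof (induction "card (fv q \<inter> E)" arbitrary: p q)
  case 0
  then have disj: "fv (\<^bold>\<not> q) \<inter> E = {}" by (simp add: finite_fv)
  have "derives_NEC Ax {\<^bold>\<not> q} (p \<^bold>\<longrightarrow> q)" "derives_NEC Ax {\<^bold>\<not> q} p"
    by (rule avoidingD[OF 0(2)] avoidingD[OF 0(3)]; use disj in simp)+
  moreover have "derives_NEC Ax {\<^bold>\<not> q} (\<^bold>\<not> q)" by (simp add: derives_NEC.Assm)
  ultimately show ?case
    using derives_NEC.Contr[of Ax q "{}" "p \<^bold>\<and> \<^bold>\<not> q"] derives_NEC.ConjI[of Ax "{\<^bold>\<not> q}" p "\<^bold>\<not> q"] by simp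
next
  case (Suc n)
  from Suc.hyps(2) have "fv q \<inter> E \<noteq> {}" by (metis card.empty nat.distinct(1))
  then obtain x where x: "x \<in> fv q" "x \<in> E" by blast
  have "finite (E \<union> allv p \<union> allv q)"
    using avoiding_finite[OF Suc.prems(1)] by (simp add: finite_allv)
  from ex_new_if_finite[OF infinite_UNIV_nat this]
  obtain y where y: "y \<notin> E \<union> allv p \<union> allv q" ..
  let ?r = "subst x (Var y)"
  have "fv (?r q) \<inter> E = fv q \<inter> E - {x}"
    using y by (auto dest: fv_subst_varD intro: fv_subst_varI)
  then have "n = card (fv (?r q) \<inter> E)"
    using Suc.hyps(2) x by (simp add: card_Diff_singleton)
  moreover have "avoiding Ax E {} (?r p \<^bold>\<longrightarrow> ?r q)" "avoiding Ax E {} (?r p)"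
    using avoiding_rename[OF Suc.prems(1) x(2), of y] avoiding_rename[OF Suc.prems(2) x(2), of y] y
    by simp_all
  ultimately have "derives_NEC Ax {} (?r q)"
    by (rule Suc.hyps(1))
  then show ?case by (rule derives_rename_back) (use y in simp)
qed

lemma derives_mp:
  assumes "derives_NEC Ax {} (p \<^bold>\<longrightarrow> q)" "derives_NEC Ax {} p"
  shows "derives_NEC Ax {} q"
proof -
  obtain E where "avoiding Ax E {} (p \<^bold>\<longrightarrow> q)" "avoiding Ax E {} p"
    by (rule avoiding_join[OF derives_avoiding[OF assms(1)] derives_avoiding[OF assms(2)]])
  then show ?thesis by (rule avoiding_mp)
qed

section \<open>A Hilbert-style consequence relation\<close>

text \<open>\<open>derives_NEC\<close> is not visibly closed under weakening, since an added assumption may contain an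
  eigenvariable free. Derivability from all larger sets is, and it obeys every rule except \<open>AllI\<close>.\<close>

definition derives_above :: "fm set \<Rightarrow> fm set \<Rightarrow> fm \<Rightarrow> bool" where
  "derives_above Ax \<Gamma> p \<longleftrightarrow> (\<forall>\<Delta>. \<Gamma> \<subseteq> \<Delta> \<longrightarrow> derives_NEC Ax \<Delta> p)"

lemma above_imp_derives: "derives_above Ax \<Gamma> p \<Longrightarrow> derives_NEC Ax \<Gamma> p"
  by (auto simp: derives_above_def)

lemma above_Assm: "p \<in> \<Gamma> \<Longrightarrow> derives_above Ax \<Gamma> p"
  by (auto simp: derives_above_def intro: derives_NEC.Assm)

lemma above_NegI:
  "derives_above Ax (insert p \<Gamma>) q \<Longrightarrow> derives_above Ax (insert p \<Gamma>) (\<^bold>\<not> q) \<Longrightarrow> derives_above Ax \<Gamma> (\<^bold>\<not> p)"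
  unfolding derives_above_def
  by (intro allI impI, rule derives_NEC.NegI[of Ax p _ q]; drule spec, erule mp, erule insert_mono)

lemma above_Contr:
  "derives_above Ax (insert (\<^bold>\<not> p) \<Gamma>) q \<Longrightarrow> derives_above Ax (insert (\<^bold>\<not> p) \<Gamma>) (\<^bold>\<not> q) \<Longrightarrow> derives_above Ax \<Gamma> p"
  unfolding derives_above_def
  by (intro allI impI, rule derives_NEC.Contr[of Ax p _ q]; drule spec, erule mp, erule insert_mono)

lemma above_ConjI: "derives_above Ax \<Gamma> p \<Longrightarrow> derives_above Ax \<Gamma> q \<Longrightarrow> derives_above Ax \<Gamma> (p \<^bold>\<and> q)"
  by (auto simp: derives_above_def intro: derives_NEC.ConjI)

lemma above_ConjE1: "derives_above Ax \<Gamma> (p \<^bold>\<and> q) \<Longrightarrow> derives_above Ax \<Gamma> p"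
  using derives_NEC.ConjE1[of Ax _ p q] by (simp add: derives_above_def)

lemma above_ConjE2: "derives_above Ax \<Gamma> (p \<^bold>\<and> q) \<Longrightarrow> derives_above Ax \<Gamma> q"
  using derives_NEC.ConjE2[of Ax _ p q] by (simp add: derives_above_def)

lemma above_AllE: "derives_above Ax \<Gamma> (\<^bold>\<forall>x. p) \<Longrightarrow> free_for x t p \<Longrightarrow> derives_above Ax \<Gamma> (subst x t p)"
  using derives_NEC.AllE[of Ax _ x p t] by (simp add: derives_above_def)

lemma above_EqRefl: "derives_above Ax \<Gamma> (t \<^bold>= t)"
  by (auto simp: derives_above_def intro: derives_NEC.EqRefl)

lemma above_EqSubst:
  "derives_above Ax \<Gamma> (s \<^bold>= t) \<Longrightarrow> derives_above Ax \<Gamma> (subst x s p) \<Longrightarrow>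
    free_for x s p \<Longrightarrow> free_for x t p \<Longrightarrow> derives_above Ax \<Gamma> (subst x t p)"
  using derives_NEC.EqSubst[of Ax _ s t x p] by (simp add: derives_above_def)

lemma above_mono: "derives_above Ax \<Gamma> p \<Longrightarrow> \<Gamma> \<subseteq> \<Delta> \<Longrightarrow> derives_above Ax \<Delta> p"
  by (auto simp: derives_above_def)

lemma above_ImpI:
  assumes "derives_above Ax (insert p \<Gamma>) q"
  shows "derives_above Ax \<Gamma> (p \<^bold>\<longrightarrow> q)"
proof (rule above_NegI)
  let ?X = "p \<^bold>\<and> \<^bold>\<not> q"
  show "derives_above Ax (insert ?X \<Gamma>) p"
    by (rule above_ConjE1[OF above_Assm[of ?X]]) simp
  show "derives_above Ax (insert ?X \<Gamma>) (\<^bold>\<not> p)"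
  proof (rule above_NegI)
    show "derives_above Ax (insert p (insert ?X \<Gamma>)) q"
      by (rule above_mono[OF assms]) auto
    show "derives_above Ax (insert p (insert ?X \<Gamma>)) (\<^bold>\<not> q)"
      by (rule above_ConjE2[OF above_Assm[of ?X]]) simp
  qed
qed

lemma above_ImpE:
  assumes "derives_above Ax \<Gamma> (p \<^bold>\<longrightarrow> q)" "derives_above Ax \<Gamma> p"
  shows "derives_above Ax \<Gamma> q"
proof (rule above_Contr)
  show "derives_above Ax (insert (\<^bold>\<not> q) \<Gamma>) (p \<^bold>\<and> \<^bold>\<not> q)"
    by (intro above_ConjI above_Assm above_mono[OF assms(2)]) auto
  show "derives_above Ax (insert (\<^bold>\<not> q) \<Gamma>) (p \<^bold>\<longrightarrow> q)"
    by (rule above_mono[OF assms(1)]) auto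
qed

text \<open>All theorems act as logical axioms, so \<open>AllI\<close> and \<open>NEC\<close> stay
  inside the empty context. With \<open>MP\<close> as the only rule, weakening is a plain
  induction.\<close>

inductive hilb :: "fm set \<Rightarrow> fm set \<Rightarrow> fm \<Rightarrow> bool" for Ax \<Gamma> where
  Thm: "derives_NEC Ax {} p \<Longrightarrow> hilb Ax \<Gamma> p"
| Hyp: "p \<in> \<Gamma> \<Longrightarrow> hilb Ax \<Gamma> p"
| MP: "hilb Ax \<Gamma> (p \<^bold>\<longrightarrow> q) \<Longrightarrow> hilb Ax \<Gamma> p \<Longrightarrow> hilb Ax \<Gamma> q"

text \<open>The way back to the original calculus; cut for theorems, \<open>derives_mp\<close>, was
  proved for this.\<close>

lemma hilb_empty: "hilb Ax {} p \<Longrightarrow> derives_NEC Ax {} p"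
  by (induction rule: hilb.induct) (auto intro: derives_mp)

lemma hilb_mono: "hilb Ax \<Gamma> p \<Longrightarrow> \<Gamma> \<subseteq> \<Delta> \<Longrightarrow> hilb Ax \<Delta> p"
  by (induction rule: hilb.induct) (auto intro: hilb.intros)

lemma hilb_above: "derives_above Ax {} p \<Longrightarrow> hilb Ax \<Gamma> p"
  by (intro hilb.Thm above_imp_derives)

lemma hilb_deduction:
  assumes "hilb Ax (insert p \<Gamma>) q"
  shows "hilb Ax \<Gamma> (p \<^bold>\<longrightarrow> q)"
proof -
  have K: "hilb Ax \<Gamma> (a \<^bold>\<longrightarrow> b \<^bold>\<longrightarrow> a)" for a b
    by (intro hilb_above above_ImpI above_Assm) auto
  show ?thesis
    using assms
  proof (induction rule: hilb.induct)
    case (Thm q)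
    then show ?case by (rule hilb.MP[OF K hilb.Thm])
  next
    case (Hyp q)
    then show ?case
    proof
      assume "q = p"
      then show ?thesis by (simp only:) (intro hilb_above above_ImpI above_Assm insertI1)
    qed (rule hilb.MP[OF K hilb.Hyp])
  next
    case (MP a b)
    \<comment> \<open>The combinator axiom S, which together with \<open>K\<close> gives the usual
      deduction theorem.\<close>
    have "hilb Ax \<Gamma> ((p \<^bold>\<longrightarrow> a \<^bold>\<longrightarrow> b) \<^bold>\<longrightarrow> (p \<^bold>\<longrightarrow> a) \<^bold>\<longrightarrow> p \<^bold>\<longrightarrow> b)"
    proof (intro hilb_above above_ImpI)
      let ?D = "{p, p \<^bold>\<longrightarrow> a, p \<^bold>\<longrightarrow> a \<^bold>\<longrightarrow> b}"
      have "derives_above Ax ?D (a \<^bold>\<longrightarrow> b)" "derives_above Ax ?D a"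
        by (rule above_ImpE[of _ _ p]; rule above_Assm; simp)+
      then show "derives_above Ax ?D b" by (rule above_ImpE)
    qed
    from hilb.MP[OF hilb.MP[OF this MP.IH(1)] MP.IH(2)] show ?case .
  qed
qed

lemma hilb_rule1:
  assumes "derives_above Ax {p} q" "hilb Ax \<Gamma> p"
  shows "hilb Ax \<Gamma> q"
  by (rule hilb.MP[OF hilb_above[OF above_ImpI[OF assms(1)]] assms(2)])

lemma hilb_rule2:
  assumes "derives_above Ax {p, q} r" "hilb Ax \<Gamma> p" "hilb Ax \<Gamma> q"
  shows "hilb Ax \<Gamma> r"
proof -
  have "derives_above Ax {q, p} r" using assms(1) by (simp add: insert_commute)
  then have "hilb Ax \<Gamma> (p \<^bold>\<longrightarrow> q \<^bold>\<longrightarrow> r)" by (intro hilb_above above_ImpI)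
  from hilb.MP[OF hilb.MP[OF this assms(2)] assms(3)] show ?thesis .
qed

text \<open>Generalization is recovered by induction: theorems use \<open>AllI\<close>, a hypothesis
  without \<open>x\<close> free implies its own generalization, and \<open>MP\<close> is handled by
  distributing the quantifier over the implication.\<close>

lemma hilb_gen:
  assumes "hilb Ax \<Gamma> p" "\<forall>q\<in>\<Gamma>. x \<notin> fv q"
  shows "hilb Ax \<Gamma> (\<^bold>\<forall>x. p)"
  using assms
proof (induction rule: hilb.induct)
  case (Thm p)
  then show ?case by (auto intro: hilb.Thm derives_NEC.AllI)
next
  case (Hyp p)
  have "derives_NEC Ax {} (p \<^bold>\<longrightarrow> (\<^bold>\<forall>x. p))"
  proof (rule derives_NEC.NegI)
    let ?X = "p \<^bold>\<and> \<^bold>\<not> (\<^bold>\<forall>x. p)"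
    show "derives_NEC Ax {?X} (\<^bold>\<forall>x. p)"
      using Hyp by (intro derives_NEC.AllI derives_NEC.ConjE1[OF derives_NEC.Assm[of ?X]]) auto
    show "derives_NEC Ax {?X} (\<^bold>\<not> (\<^bold>\<forall>x. p))"
      by (rule derives_NEC.ConjE2[OF derives_NEC.Assm[of ?X]]) simp
  qed
  from hilb.MP[OF hilb.Thm[OF this] hilb.Hyp[OF Hyp(1)]] show ?case .
next
  case (MP p q)
  have "derives_NEC Ax {} (((\<^bold>\<forall>x. p \<^bold>\<longrightarrow> q) \<^bold>\<and> (\<^bold>\<forall>x. p)) \<^bold>\<longrightarrow> (\<^bold>\<forall>x. q))"
  proof (rule derives_NEC.NegI)
    let ?X = "((\<^bold>\<forall>x. p \<^bold>\<longrightarrow> q) \<^bold>\<and> (\<^bold>\<forall>x. p)) \<^bold>\<and> \<^bold>\<not> (\<^bold>\<forall>x. q)"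
    have X: "derives_above Ax {?X} ?X" by (simp add: above_Assm)
    have "derives_above Ax {?X} (p \<^bold>\<longrightarrow> q)"
      using above_AllE[OF above_ConjE1[OF above_ConjE1[OF X]] free_for_self] unfolding subst_self .
    moreover have "derives_above Ax {?X} p"
      using above_AllE[OF above_ConjE2[OF above_ConjE1[OF X]] free_for_self] unfolding subst_self .
    ultimately have "derives_above Ax {?X} q"
      by (rule above_ImpE)
    then show "derives_NEC Ax {?X} (\<^bold>\<forall>x. q)"
      by (intro derives_NEC.AllI above_imp_derives) auto
    show "derives_NEC Ax {?X} (\<^bold>\<not> (\<^bold>\<forall>x. q))"
      by (rule above_imp_derives[OF above_ConjE2[OF X]])
  qed
  moreover have "hilb Ax \<Gamma> ((\<^bold>\<forall>x. p \<^bold>\<longrightarrow> q) \<^bold>\<and> (\<^bold>\<forall>x. p))"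
    by (rule hilb_rule2[OF above_ConjI[OF above_Assm above_Assm] MP.IH]) (use MP.prems in auto)
  ultimately show ?case by (rule hilb.MP[OF hilb.Thm])
qed

section \<open>Structures and satisfaction\<close>

text \<open>The domain is a set rather than the whole type because the term model lives on chosen
  representatives among the terms.\<close>

record 'a model =
  Dom :: "'a set"
  IZero :: 'a
  ISucc :: "'a \<Rightarrow> 'a"
  IPlus :: "'a \<Rightarrow> 'a \<Rightarrow> 'a"
  ITimes :: "'a \<Rightarrow> 'a \<Rightarrow> 'a"
  IDNeg :: "'a \<Rightarrow> 'a"
  IDConj :: "'a \<Rightarrow> 'a \<Rightarrow> 'a"
  IDAll :: "'a \<Rightarrow> 'a \<Rightarrow> 'a"
  INuml :: "'a \<Rightarrow> 'a"
  IMem :: "'a \<Rightarrow> 'a \<Rightarrow> bool"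
  IUni :: "'a \<Rightarrow> bool"
  IMod :: "'a \<Rightarrow> 'a \<Rightarrow> 'a \<Rightarrow> bool"

primrec val :: "'a model \<Rightarrow> (nat \<Rightarrow> 'a) \<Rightarrow> tm \<Rightarrow> 'a" where
  "val M e (Var n) = e n"
| "val M e Zero = IZero M"
| "val M e (Succ t) = ISucc M (val M e t)"
| "val M e (Plus s t) = IPlus M (val M e s) (val M e t)"
| "val M e (Times s t) = ITimes M (val M e s) (val M e t)"
| "val M e (DNeg t) = IDNeg M (val M e t)"
| "val M e (DConj s t) = IDConj M (val M e s) (val M e t)"
| "val M e (DAll s t) = IDAll M (val M e s) (val M e t)"
| "val M e (Numl t) = INuml M (val M e t)"

primrec sat :: "'a model \<Rightarrow> (nat \<Rightarrow> 'a) \<Rightarrow> fm \<Rightarrow> bool" where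
  "sat M e (s \<^bold>= t) \<longleftrightarrow> val M e s = val M e t"
| "sat M e (s \<^bold>\<in> t) \<longleftrightarrow> IMem M (val M e s) (val M e t)"
| "sat M e (Uni t) \<longleftrightarrow> IUni M (val M e t)"
| "sat M e (Mod r s t) \<longleftrightarrow> IMod M (val M e r) (val M e s) (val M e t)"
| "sat M e (\<^bold>\<not> p) \<longleftrightarrow> \<not> sat M e p"
| "sat M e (p \<^bold>\<and> q) \<longleftrightarrow> sat M e p \<and> sat M e q"
| "sat M e (\<^bold>\<forall>x. p) \<longleftrightarrow> (\<forall>d\<in>Dom M. sat M (e(x := d)) p)"

definition closed_ops :: "'a model \<Rightarrow> bool" where
  "closed_ops M \<longleftrightarrow> IZero M \<in> Dom M \<and>
     (\<forall>a\<in>Dom M. ISucc M a \<in> Dom M \<and> IDNeg M a \<in> Dom M \<and> INuml M a \<in> Dom M \<and>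
       (\<forall>b\<in>Dom M. IPlus M a b \<in> Dom M \<and> ITimes M a b \<in> Dom M \<and>
          IDConj M a b \<in> Dom M \<and> IDAll M a b \<in> Dom M))"

lemma val_cong: "(\<And>n. n \<in> tvars t \<Longrightarrow> e n = e' n) \<Longrightarrow> val M e t = val M e' t"
  by (induction t) auto

lemma sat_cong: "(\<And>n. n \<in> fv p \<Longrightarrow> e n = e' n) \<Longrightarrow> sat M e p \<longleftrightarrow> sat M e' p"
proof (induction p arbitrary: e e')
  case (Eq s t)
  then show ?case using val_cong[of s e e' M] val_cong[of t e e' M] by simp
next
  case (Mem s t)
  then show ?case using val_cong[of s e e' M] val_cong[of t e e' M] by simp
next
  case (Uni t)
  then show ?case using val_cong[of t e e' M] by simp
next
  case (Mod r s t)
  then show ?case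
    using val_cong[of r e e' M] val_cong[of s e e' M] val_cong[of t e e' M] by simp
next
  case (Neg p)
  from Neg.IH[of e e'] Neg.prems show ?case by simp
next
  case (Conj p q)
  from Conj.IH(1)[of e e'] Conj.IH(2)[of e e'] Conj.prems show ?case by simp
next
  case (Forall x p)
  have "sat M (e(x := d)) p \<longleftrightarrow> sat M (e'(x := d)) p" for d
    by (rule Forall.IH) (use Forall.prems in simp)
  then show ?case by simp
qed

lemma val_tsubst: "val M e (tsubst x u t) = val M (e(x := val M e u)) t"
  by (induction t) auto

lemma sat_subst_var: "y \<notin> allv p \<Longrightarrow> sat M e (subst x (Var y) p) \<longleftrightarrow> sat M (e(x := e y)) p"
proof (induction p arbitrary: e)
  case (Forall z p)
  have "sat M (e(z := d)) (subst x (Var y) p) \<longleftrightarrow> sat M (e(x := e y, z := d)) p" if "z \<noteq> x" for d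
  proof -
    have "(e(z := d)) y = e y" using Forall.prems by simp
    with Forall.IH[of "e(z := d)"] Forall.prems fun_upd_twist[OF that, of e d "e y"]
    show ?thesis by (metis UnI2 allv.simps(7) insertCI)
  qed
  then show ?case by (cases "z = x") (simp_all del: fun_upd_apply)
qed (simp_all add: val_tsubst)

text \<open>Passes from a universal closure, true under one assignment, to the formula under any
  assignment into the domain.\<close>

lemma sat_foldr_Forall:
  assumes "sat M e (foldr Forall xs p)" "\<And>n. e' n \<in> Dom M"
  shows "sat M (override_on e e' (set xs)) p"
  using assms(1)
proof (induction xs arbitrary: e)
  case (Cons x xs)
  then have "sat M (e(x := e' x)) (foldr Forall xs p)" using assms(2) by simp
  from Cons.IH[OF this]
  show ?case by (rule back_subst[of "\<lambda>e. sat M e p"]) (auto simp: override_on_def)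
qed simp

section \<open>Completeness\<close>

definition consistent :: "fm set \<Rightarrow> fm set \<Rightarrow> bool" where
  "consistent Ax \<Gamma> \<longleftrightarrow> \<not> (\<exists>q. hilb Ax \<Gamma> q \<and> hilb Ax \<Gamma> (\<^bold>\<not> q))"

lemma inconsistent_insert:
  assumes "\<not> consistent Ax (insert p \<Gamma>)"
  shows "hilb Ax \<Gamma> (\<^bold>\<not> p)"
proof -
  obtain q where q: "hilb Ax (insert p \<Gamma>) q" "hilb Ax (insert p \<Gamma>) (\<^bold>\<not> q)"
    using assms by (auto simp: consistent_def)
  show ?thesis
  proof (rule hilb_rule2[OF _ hilb_deduction[OF q(1)] hilb_deduction[OF q(2)]])
    let ?D = "{p, p \<^bold>\<longrightarrow> q, p \<^bold>\<longrightarrow> \<^bold>\<not> q}"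
    have "derives_above Ax ?D q" "derives_above Ax ?D (\<^bold>\<not> q)"
      by (rule above_ImpE[of _ _ p]; rule above_Assm; simp)+
    then show "derives_above Ax {p \<^bold>\<longrightarrow> q, p \<^bold>\<longrightarrow> \<^bold>\<not> q} (\<^bold>\<not> p)"
      by (rule above_NegI)
  qed
qed

lemma hilb_DN: "hilb Ax \<Gamma> (\<^bold>\<not> \<^bold>\<not> p) \<Longrightarrow> hilb Ax \<Gamma> p"
  by (erule hilb_rule1[rotated], rule above_Contr[of _ _ _ "\<^bold>\<not> p"]; rule above_Assm; simp)

text \<open>Otherwise the instance at \<open>y\<close> would follow from \<open>\<Gamma>\<close>. As
  \<open>y\<close> is not free there, it could be generalized and the bound variable renamed to
  \<open>x\<close>, against the negated universal formula in \<open>\<Gamma>\<close>.\<close>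

lemma consistent_witness:
  assumes con: "consistent Ax \<Gamma>" and mem: "\<^bold>\<not> (\<^bold>\<forall>x. p) \<in> \<Gamma>"
    and y: "y \<notin> allv p" "\<forall>q\<in>\<Gamma>. y \<notin> fv q"
  shows "consistent Ax (insert (\<^bold>\<not> subst x (Var y) p) \<Gamma>)"
proof (rule ccontr)
  let ?q = "\<^bold>\<forall>y. subst x (Var y) p"
  assume "\<not> ?thesis"
  then have "hilb Ax \<Gamma> (subst x (Var y) p)"
    by (rule hilb_DN[OF inconsistent_insert])
  then have "hilb Ax \<Gamma> ?q" using y(2) by (rule hilb_gen)
  moreover have "hilb Ax {?q} (\<^bold>\<forall>x. p)"
  proof (rule hilb_gen)
    have "derives_above Ax {?q} (subst y (Var x) (subst x (Var y) p))"
      by (rule above_AllE[OF above_Assm free_for_back[OF y(1)]]) simp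
    then show "hilb Ax {?q} p"
      unfolding subst_back[OF y(1)] by (rule hilb_rule1) (simp add: hilb.Hyp)
    show "\<forall>r\<in>{?q}. x \<notin> fv r" using fv_subst_varD[of x x y p] by auto
  qed
  then have "hilb Ax {} (?q \<^bold>\<longrightarrow> (\<^bold>\<forall>x. p))" by (rule hilb_deduction)
  then have "hilb Ax \<Gamma> (?q \<^bold>\<longrightarrow> (\<^bold>\<forall>x. p))" by (rule hilb_mono) simp
  ultimately have "hilb Ax \<Gamma> (\<^bold>\<forall>x. p)" by (rule hilb.MP[rotated])
  with con hilb.Hyp[OF mem] show False by (auto simp: consistent_def)
qed

text \<open>One stage of the Lindenbaum construction: \<open>q\<close> is refuted or accepted, and
  an accepted negated universal formula gets its witness at once. Finiteness of
  \<open>\<Gamma>\<close> guarantees a fresh variable.\<close>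

lemma consistent_step:
  assumes "finite \<Gamma>" "consistent Ax \<Gamma>"
  shows "\<exists>\<Delta>. finite \<Delta> \<and> consistent Ax \<Delta> \<and> \<Gamma> \<subseteq> \<Delta> \<and>
    (hilb Ax \<Delta> (\<^bold>\<not> q) \<or>
     q \<in> \<Delta> \<and> (\<forall>x p. q = \<^bold>\<not> (\<^bold>\<forall>x. p) \<longrightarrow> (\<exists>y. y \<notin> allv p \<and> \<^bold>\<not> subst x (Var y) p \<in> \<Delta>)))"
proof (cases "consistent Ax (insert q \<Gamma>)")
  case True
  show ?thesis
  proof (cases "\<exists>x p. q = \<^bold>\<not> (\<^bold>\<forall>x. p)")
    case True
    then obtain x p where q: "q = \<^bold>\<not> (\<^bold>\<forall>x. p)" by blast
    have "finite (allv p \<union> (\<Union>r\<in>insert q \<Gamma>. fv r))"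
      using assms(1) by (simp add: finite_allv finite_fv)
    from ex_new_if_finite[OF infinite_UNIV_nat this]
    obtain y where y: "y \<notin> allv p" "\<forall>r\<in>insert q \<Gamma>. y \<notin> fv r" by blast
    have "consistent Ax (insert (\<^bold>\<not> subst x (Var y) p) (insert q \<Gamma>))"
      using \<open>consistent Ax (insert q \<Gamma>)\<close> y by (intro consistent_witness) (auto simp: q)
    with q y assms(1) show ?thesis
      by (intro exI[of _ "insert (\<^bold>\<not> subst x (Var y) p) (insert q \<Gamma>)"]) auto
  next
    case False
    with True assms(1) show ?thesis by (intro exI[of _ "insert q \<Gamma>"]) auto
  qed
next
  case False
  with assms inconsistent_insert show ?thesis by (intro exI[of _ \<Gamma>]) auto
qed

section \<open>Maximal consistent sets with witnesses\<close>

instance tm :: countable by countable_datatype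

instance fm :: countable by countable_datatype

text \<open>Witnesses are variables of the original language, so no constants are added; a witness
  outside \<open>allv p\<close> makes the substitution free of capture.\<close>

locale henkin =
  fixes Ax H :: "fm set"
  assumes closed: "hilb Ax H p \<Longrightarrow> p \<in> H"
    and Neg_iff: "\<^bold>\<not> p \<in> H \<longleftrightarrow> p \<notin> H"
    and witness: "(\<^bold>\<forall>x. p) \<notin> H \<Longrightarrow> \<exists>y. y \<notin> allv p \<and> subst x (Var y) p \<notin> H"

text \<open>Stage \<open>n\<close> treats the formula \<open>from_nat n\<close>. Every stage is
  finite, so fresh variables remain, and \<open>H\<close> is the union of all stages.\<close>

lemma henkin_extension:
  assumes "\<not> derives_NEC Ax {} p0"
  shows "\<exists>H. henkin Ax H \<and> p0 \<notin> H"
proof -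
  let ?P = "\<lambda>\<Gamma>. finite \<Gamma> \<and> consistent Ax \<Gamma> \<and> \<^bold>\<not> p0 \<in> \<Gamma>"
  let ?Q = "\<lambda>n \<Gamma> \<Delta>. \<Gamma> \<subseteq> \<Delta> \<and> (hilb Ax \<Delta> (\<^bold>\<not> from_nat n) \<or> from_nat n \<in> \<Delta> \<and>
     (\<forall>x p. from_nat n = \<^bold>\<not> (\<^bold>\<forall>x. p) \<longrightarrow> (\<exists>y. y \<notin> allv p \<and> \<^bold>\<not> subst x (Var y) p \<in> \<Delta>)))"
  have "\<exists>f. \<forall>n. ?P (f n) \<and> ?Q n (f n) (f (Suc n))"
  proof (rule dependent_nat_choice)
    have "consistent Ax {\<^bold>\<not> p0}"
    proof (rule ccontr)
      assume "\<not> ?thesis"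
      then have "hilb Ax {} p0" by (rule hilb_DN[OF inconsistent_insert])
      with assms hilb_empty show False by blast
    qed
    then show "\<exists>\<Gamma>. ?P \<Gamma>" by (intro exI[of _ "{\<^bold>\<not> p0}"]) simp
  next
    fix \<Gamma> n assume P: "?P \<Gamma>"
    then obtain \<Delta> where "finite \<Delta>" "consistent Ax \<Delta>" "?Q n \<Gamma> \<Delta>"
      using consistent_step[of \<Gamma> Ax "from_nat n"] by blast
    then show "\<exists>\<Delta>. ?P \<Delta> \<and> ?Q n \<Gamma> \<Delta>" using P by (intro exI[of _ \<Delta>]) blast
  qed
  then obtain f where "\<forall>n. ?P (f n) \<and> ?Q n (f n) (f (Suc n))" ..
  then have P: "?P (f n)" and Q: "?Q n (f n) (f (Suc n))" for n by simp_all
  define H where "H = (\<Union>n. f n)"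
  have sub: "f n \<subseteq> H" for n by (auto simp: H_def)
  have mono: "f m \<subseteq> f n" if "m \<le> n" for m n
    by (rule lift_Suc_mono_le[of f, OF _ that]) (rule conjunct1[OF Q])
  have up: "hilb Ax (f n) q" if "hilb Ax (f m) q" "m \<le> n" for m n q
    by (rule hilb_mono[OF that(1) mono[OF that(2)]])
  \<comment> \<open>Compactness: a derivation uses finitely many hypotheses, all present at some
    stage.\<close>
  have bounded: "\<exists>n. hilb Ax (f n) q" if "hilb Ax H q" for q
    using that
  proof (induction rule: hilb.induct)
    case (Thm p)
    then show ?case by (blast intro: hilb.Thm)
  next
    case (Hyp p)
    then show ?case by (auto simp: H_def intro: hilb.Hyp)
  next
    case (MP p q)
    then obtain m n where "hilb Ax (f m) (p \<^bold>\<longrightarrow> q)" "hilb Ax (f n) p" by blast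
    from up[OF this(1), of "max m n"] up[OF this(2), of "max m n"]
    have "hilb Ax (f (max m n)) (p \<^bold>\<longrightarrow> q)" "hilb Ax (f (max m n)) p"
      by simp_all
    then have "hilb Ax (f (max m n)) q" by (rule hilb.MP)
    then show ?case ..
  qed
  have con: "\<not> (hilb Ax H q \<and> hilb Ax H (\<^bold>\<not> q))" for q
  proof
    assume "hilb Ax H q \<and> hilb Ax H (\<^bold>\<not> q)"
    then obtain m n where "hilb Ax (f m) q" "hilb Ax (f n) (\<^bold>\<not> q)" using bounded by blast
    from up[OF this(1), of "max m n"] up[OF this(2), of "max m n"]
    have "hilb Ax (f (max m n)) q" "hilb Ax (f (max m n)) (\<^bold>\<not> q)"
      by simp_all
    with P[of "max m n"] show False by (auto simp: consistent_def)
  qed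
  \<comment> \<open>The outcome of stage \<open>to_nat q\<close>, where \<open>q\<close> is treated,
    persists in \<open>H\<close>.\<close>
  have stage: "hilb Ax H (\<^bold>\<not> q) \<or> q \<in> H \<and>
     (\<forall>x p. q = \<^bold>\<not> (\<^bold>\<forall>x. p) \<longrightarrow> (\<exists>y. y \<notin> allv p \<and> \<^bold>\<not> subst x (Var y) p \<in> H))" for q
    using conjunct2[OF Q[of "to_nat q"]] subsetD[OF sub[of "Suc (to_nat q)"]]
      hilb_mono[OF _ sub[of "Suc (to_nat q)"], of Ax]
    unfolding from_nat_to_nat by metis
  have closed: "q \<in> H" if "hilb Ax H q" for q
    using con stage that by blast
  have neg: "\<^bold>\<not> q \<in> H \<longleftrightarrow> q \<notin> H" for q
    using con[of q] stage[of q] closed hilb.Hyp by blast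
  have "\<exists>y. y \<notin> allv p \<and> subst x (Var y) p \<notin> H" if "(\<^bold>\<forall>x. p) \<notin> H" for x p
  proof -
    have "\<^bold>\<not> (\<^bold>\<forall>x. p) \<in> H" using that neg by blast
    then have "\<not> hilb Ax H (\<^bold>\<not> \<^bold>\<not> (\<^bold>\<forall>x. p))" using con hilb.Hyp by blast
    then obtain y where "y \<notin> allv p" "\<^bold>\<not> subst x (Var y) p \<in> H"
      using stage[of "\<^bold>\<not> (\<^bold>\<forall>x. p)"] by blast
    with neg show ?thesis by blast
  qed
  with closed neg have "henkin Ax H" by unfold_locales
  moreover have "p0 \<notin> H" using neg[of p0] P[of 0] sub[of 0] by blast
  ultimately show ?thesis by blast
qed

section \<open>The term model of a Henkin set\<close>

context henkin
begin

lemma above1: "derives_above Ax {p} q \<Longrightarrow> p \<in> H \<Longrightarrow> q \<in> H"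
  by (rule closed[OF hilb_rule1[OF _ hilb.Hyp]])

lemma above2: "derives_above Ax {p, q} r \<Longrightarrow> p \<in> H \<Longrightarrow> q \<in> H \<Longrightarrow> r \<in> H"
  by (rule closed[OF hilb_rule2[OF _ hilb.Hyp hilb.Hyp]])

lemma Conj_iff: "p \<^bold>\<and> q \<in> H \<longleftrightarrow> p \<in> H \<and> q \<in> H"
proof
  have "derives_above Ax {p \<^bold>\<and> q} (p \<^bold>\<and> q)" by (simp add: above_Assm)
  then show "p \<^bold>\<and> q \<in> H \<Longrightarrow> p \<in> H \<and> q \<in> H"
    by (auto intro: above1[OF above_ConjE1] above1[OF above_ConjE2])
  show "p \<in> H \<and> q \<in> H \<Longrightarrow> p \<^bold>\<and> q \<in> H"
    by (auto intro: above2[OF above_ConjI[OF above_Assm above_Assm]])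
qed

lemma Forall_inst: "(\<^bold>\<forall>x. p) \<in> H \<Longrightarrow> free_for x t p \<Longrightarrow> subst x t p \<in> H"
  by (rule above1[OF above_AllE[OF above_Assm]]) auto

definition eqv :: "tm \<Rightarrow> tm \<Rightarrow> bool" where
  "eqv s t \<longleftrightarrow> (s \<^bold>= t) \<in> H"

lemma eqv_subst:
  "eqv s t \<Longrightarrow> subst x s p \<in> H \<Longrightarrow> free_for x s p \<Longrightarrow> free_for x t p \<Longrightarrow> subst x t p \<in> H"
  unfolding eqv_def
  by (rule above2[of "s \<^bold>= t" "subst x s p", OF above_EqSubst[of _ _ s t x p, OF above_Assm above_Assm]]) simp_all

lemma eqv_refl: "eqv t t"
  unfolding eqv_def by (rule closed[OF hilb_above[OF above_EqRefl]])

lemma new_var: "\<exists>x. x \<notin> tvars s \<and> x \<notin> tvars t \<and> x \<notin> allv p"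
proof -
  have "finite (tvars s \<union> tvars t \<union> allv p)" by (simp add: finite_tvars finite_allv)
  from ex_new_if_finite[OF infinite_UNIV_nat this] show ?thesis by blast
qed

lemma eqv_sym:
  assumes "eqv s t"
  shows "eqv t s"
proof -
  obtain x where "x \<notin> tvars s" using new_var by blast
  with assms eqv_refl[of s] show ?thesis
    using eqv_subst[of s t x "Var x \<^bold>= s"] by (simp add: eqv_def tsubst_fresh)
qed

lemma eqv_trans:
  assumes "eqv r s" "eqv s t"
  shows "eqv r t"
proof -
  obtain x where "x \<notin> tvars r" using new_var by blast
  with assms show ?thesis
    using eqv_subst[of s t x "r \<^bold>= Var x"] by (simp add: eqv_def tsubst_fresh)
qed

text \<open>\<open>F\<close> stands for a term constructor, for which \<open>hom\<close> is an
  equation of \<open>tsubst\<close>. Equals are substituted in \<open>F s = F x\<close> with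
  \<open>x\<close> absent from \<open>s\<close>.\<close>

lemma eqv_cong1:
  assumes hom: "\<And>x u a. tsubst x u (F a) = F (tsubst x u a)" and "eqv s t"
  shows "eqv (F s) (F t)"
proof -
  obtain x where "x \<notin> tvars s" using new_var by blast
  with assms(2) eqv_refl[of "F s"] show ?thesis
    using eqv_subst[of s t x "F s \<^bold>= F (Var x)"] by (simp add: eqv_def hom tsubst_fresh)
qed

lemma eqv_cong2:
  assumes hom: "\<And>x u a b. tsubst x u (F a b) = F (tsubst x u a) (tsubst x u b)"
    and "eqv s t" "eqv s' t'"
  shows "eqv (F s s') (F t t')"
proof (rule eqv_trans)
  obtain x where "x \<notin> tvars s" "x \<notin> tvars s'" using new_var by blast
  with assms(2) eqv_refl[of "F s s'"] show "eqv (F s s') (F t s')"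
    using eqv_subst[of s t x "F s s' \<^bold>= F (Var x) s'"] by (simp add: eqv_def hom tsubst_fresh)
  obtain y where "y \<notin> tvars t" "y \<notin> tvars s'" using new_var by blast
  with assms(3) eqv_refl[of "F t s'"] show "eqv (F t s') (F t t')"
    using eqv_subst[of s' t' y "F t s' \<^bold>= F t (Var y)"] by (simp add: eqv_def hom tsubst_fresh)
qed

lemma Mem_cong:
  assumes "eqv s t" "eqv s' t'" "(s \<^bold>\<in> s') \<in> H"
  shows "(t \<^bold>\<in> t') \<in> H"
proof -
  obtain x where "x \<notin> tvars s'" using new_var by blast
  with assms have "(t \<^bold>\<in> s') \<in> H"
    using eqv_subst[of s t x "Var x \<^bold>\<in> s'"] by (simp add: tsubst_fresh)
  moreover obtain y where "y \<notin> tvars t" using new_var by blast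
  ultimately show ?thesis
    using eqv_subst[OF assms(2), of y "t \<^bold>\<in> Var y"] by (simp add: tsubst_fresh)
qed

lemma Uni_cong: "eqv s t \<Longrightarrow> Uni s \<in> H \<Longrightarrow> Uni t \<in> H"
  using eqv_subst[of s t 0 "Uni (Var 0)"] by simp

lemma Mod_cong:
  assumes "eqv a a'" "eqv b b'" "eqv c c'" "Mod a b c \<in> H"
  shows "Mod a' b' c' \<in> H"
proof -
  obtain x where "x \<notin> tvars b" "x \<notin> tvars c" using new_var by blast
  with assms have "Mod a' b c \<in> H"
    using eqv_subst[of a a' x "Mod (Var x) b c"] by (simp add: tsubst_fresh)
  moreover obtain y where "y \<notin> tvars a'" "y \<notin> tvars c" using new_var by blast
  ultimately have "Mod a' b' c \<in> H"
    using eqv_subst[OF assms(2), of y "Mod a' (Var y) c"] by (simp add: tsubst_fresh)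
  moreover obtain z where "z \<notin> tvars a'" "z \<notin> tvars b'" using new_var by blast
  ultimately show ?thesis
    using eqv_subst[OF assms(3), of z "Mod a' b' (Var z)"] by (simp add: tsubst_fresh)
qed

text \<open>Instances of quantifiers are controlled only at variables without capture, so each term
  needs an equal variable that is safe for \<open>p\<close>. It arises as a witness for the
  existence of something equal to \<open>t\<close>.\<close>

lemma eqv_var: "\<exists>y. y \<notin> allv p \<and> eqv (Var y) t"
proof -
  obtain z where z: "z \<notin> tvars t" "z \<notin> allv p" using new_var by blast
  have fresh: "subst z u p = p \<and> free_for z u p" for u
    using z(2) by (induction p) (use fv_subset_allv in \<open>auto simp: tsubst_fresh\<close>)
  \<comment> \<open>The tautology in \<open>p\<close> is padding: a witness outside
    \<open>allv ?q\<close> is then also outside \<open>allv p\<close>.\<close>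
  let ?q = "\<^bold>\<not> (Var z \<^bold>= t \<^bold>\<and> \<^bold>\<not> (p \<^bold>\<and> \<^bold>\<not> p))"
  have "subst z t ?q \<notin> H"
    using eqv_refl[of t] z fresh by (simp add: Neg_iff Conj_iff eqv_def tsubst_fresh)
  then have "(\<^bold>\<forall>z. ?q) \<notin> H"
    using Forall_inst[of z ?q t] fresh by auto
  then obtain y where "y \<notin> allv ?q" "subst z (Var y) ?q \<notin> H"
    using witness by blast
  with z show ?thesis
    by (intro exI[of _ y]) (simp add: Neg_iff Conj_iff eqv_def tsubst_fresh)
qed

definition rep :: "tm \<Rightarrow> tm" where
  "rep t = (SOME s. eqv s t)"

lemma eqv_rep: "eqv (rep t) t"
  unfolding rep_def by (rule someI[of _ t]) (rule eqv_refl)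

lemma rep_eq_iff: "rep s = rep t \<longleftrightarrow> eqv s t"
proof
  assume "rep s = rep t"
  then show "eqv s t" using eqv_rep[of s] eqv_rep[of t] by (metis eqv_sym eqv_trans)
next
  assume "eqv s t"
  then have "eqv r s \<longleftrightarrow> eqv r t" for r using eqv_sym eqv_trans by blast
  then show "rep s = rep t" by (simp add: rep_def)
qed

definition TM :: "tm model" where
  "TM = \<lparr>Dom = range rep, IZero = rep Zero, ISucc = \<lambda>a. rep (Succ a),
     IPlus = \<lambda>a b. rep (Plus a b), ITimes = \<lambda>a b. rep (Times a b),
     IDNeg = \<lambda>a. rep (DNeg a), IDConj = \<lambda>a b. rep (DConj a b), IDAll = \<lambda>a b. rep (DAll a b),
     INuml = \<lambda>a. rep (Numl a), IMem = \<lambda>a b. (a \<^bold>\<in> b) \<in> H, IUni = \<lambda>a. Uni a \<in> H,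
     IMod = \<lambda>a b c. Mod a b c \<in> H\<rparr>"

definition env :: "nat \<Rightarrow> tm" where
  "env n = rep (Var n)"

lemma closed_ops_TM: "closed_ops TM"
  by (simp add: closed_ops_def TM_def)

lemma val_TM: "val TM env t = rep t"
proof (induction t)
  case (Var n)
  then show ?case by (simp add: env_def)
qed (simp_all add: TM_def rep_eq_iff eqv_rep
       eqv_cong1[of Succ] eqv_cong1[of DNeg] eqv_cong1[of Numl]
       eqv_cong2[of Plus] eqv_cong2[of Times] eqv_cong2[of DConj] eqv_cong2[of DAll])

text \<open>Substitution preserves \<open>height\<close>, so an instance of the body lies below the
  quantified formula although it need not be a subformula.\<close>

primrec height :: "fm \<Rightarrow> nat" where
  "height (s \<^bold>= t) = 0"
| "height (s \<^bold>\<in> t) = 0"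
| "height (Uni t) = 0"
| "height (Mod r s t) = 0"
| "height (\<^bold>\<not> p) = Suc (height p)"
| "height (p \<^bold>\<and> q) = Suc (height p + height q)"
| "height (\<^bold>\<forall>x. p) = Suc (height p)"

lemma height_subst: "height (subst x u p) = height p"
  by (induction p) auto

text \<open>The truth lemma. In the quantifier case \<open>eqv_var\<close> names every domain
  element by a variable safe for the body, and \<open>witness\<close> supplies a failing
  instance.\<close>

lemma sat_TM: "sat TM env p \<longleftrightarrow> p \<in> H"
proof (induction p rule: measure_induct_rule[of height])
  case (less p)
  show ?case
  proof (cases p)
    case (Eq s t)
    then show ?thesis by (simp add: val_TM rep_eq_iff eqv_def)
  next
    case (Mem s t)
    have "(rep s \<^bold>\<in> rep t) \<in> H \<longleftrightarrow> (s \<^bold>\<in> t) \<in> H"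
      using eqv_rep eqv_sym Mem_cong by blast
    with Mem show ?thesis by (simp add: val_TM, simp add: TM_def)
  next
    case (Uni t)
    have "Uni (rep t) \<in> H \<longleftrightarrow> Uni t \<in> H"
      using eqv_rep eqv_sym Uni_cong by blast
    with Uni show ?thesis by (simp add: val_TM, simp add: TM_def)
  next
    case (Mod r s t)
    have "Mod (rep r) (rep s) (rep t) \<in> H \<longleftrightarrow> Mod r s t \<in> H"
      using eqv_rep eqv_sym Mod_cong by blast
    with Mod show ?thesis by (simp add: val_TM, simp add: TM_def)
  next
    case (Neg q)
    with less show ?thesis by (simp add: Neg_iff)
  next
    case (Conj q r)
    with less show ?thesis by (simp add: Conj_iff)
  next
    case (Forall x q)
    have inst: "sat TM (env(x := env y)) q \<longleftrightarrow> subst x (Var y) q \<in> H" if "y \<notin> allv q" for y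
      using less[of "subst x (Var y) q"] sat_subst_var[OF that, of TM env x] Forall
      by (simp add: height_subst)
    show ?thesis
    proof
      assume "p \<in> H"
      have "sat TM (env(x := rep t)) q" for t
      proof -
        obtain y where y: "y \<notin> allv q" "eqv (Var y) t" using eqv_var by blast
        then have "env y = rep t" by (simp add: env_def rep_eq_iff)
        moreover have "subst x (Var y) q \<in> H"
          using \<open>p \<in> H\<close> Forall y(1) by (auto intro: Forall_inst free_for_new)
        ultimately show ?thesis using inst[OF y(1)] by simp
      qed
      then show "sat TM env p" unfolding Forall by (simp add: TM_def)
    next
      assume "sat TM env p"
      then have all: "sat TM (env(x := env y)) q" for y
        unfolding Forall by (simp add: TM_def env_def)
      show "p \<in> H"
      proof (rule ccontr)
        assume "p \<notin> H"
        then obtain y where "y \<notin> allv q" "subst x (Var y) q \<notin> H"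
          using witness unfolding Forall by blast
        with inst all show False by blast
      qed
    qed
  qed
qed

end

definition models :: "'a model \<Rightarrow> fm \<Rightarrow> bool" where
  "models M p \<longleftrightarrow> (\<forall>e. (\<forall>n. e n \<in> Dom M) \<longrightarrow> sat M e p)"

text \<open>A Henkin set omitting \<open>p\<close> gives a term model in which \<open>env\<close>
  refutes \<open>p\<close>. Theorems enter with their universal closures and so hold there under
  every assignment.\<close>

theorem completeness:
  assumes "\<And>M :: tm model. \<And>e. closed_ops M \<Longrightarrow> (\<And>q. derives_NEC Ax {} q \<Longrightarrow> models M q) \<Longrightarrow>
    (\<And>n. e n \<in> Dom M) \<Longrightarrow> sat M e p"
  shows "derives_NEC Ax {} p"
proof (rule ccontr)
  assume "\<not> ?thesis"
  then obtain H where "henkin Ax H" and p: "p \<notin> H"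
    using henkin_extension by blast
  then interpret henkin Ax H by simp
  have "models TM q" if q: "derives_NEC Ax {} q" for q
    unfolding models_def
  proof (intro allI impI)
    fix e' :: "nat \<Rightarrow> tm" assume e': "\<forall>n. e' n \<in> Dom TM"
    obtain xs where xs: "set xs = fv q" using finite_list[OF finite_fv] by blast
    have "derives_NEC Ax {} (foldr Forall ys q)" for ys
      by (induction ys) (auto intro: q derives_NEC.AllI)
    then have "sat TM env (foldr Forall xs q)"
      by (simp add: sat_TM closed hilb.Thm)
    then have "sat TM (override_on env e' (set xs)) q"
      by (rule sat_foldr_Forall) (use e' in blast)
    then show "sat TM e' q"
      by (subst (asm) sat_cong[of _ _ e']) (simp_all add: xs)
  qed
  then have "sat TM env p"
    by (intro assms closed_ops_TM) (simp_all add: TM_def env_def)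
  with p show False by (simp add: sat_TM)
qed

section \<open>The object theory in a structure\<close>

lemma tvars_less_above: "n \<in> tvars t \<Longrightarrow> n < above t"
  by (induction t) auto

text \<open>Here the choice of bound variables above all arguments pays off: quantifying over them
  leaves the argument values unchanged.\<close>

lemma val_upd: "above t \<le> x \<Longrightarrow> val M (e(x := d)) t = val M e t"
  by (rule val_cong) (use tvars_less_above in fastforce)

lemma above_nm [simp]: "above (nm n) = 0"
  by (induction n) auto

lemma tvars_nm [simp]: "tvars (nm n) = {}"
  by (induction n) auto

lemma above_cpair [simp]: "above (cpair s t) = max (above s) (above t)"
  by (simp add: cpair_def)

lemma above_quote [simp]: "above \<lceil>p\<rceil> = 0"
  by (simp add: quote_def)

lemma fv_is_upairD: "x \<in> fv (is_upair p a b) \<Longrightarrow> x \<in> tvars p \<union> tvars a \<union> tvars b"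
  by (auto simp: is_upair_def Let_def)

lemma fv_is_pairD: "x \<in> fv (is_pair p a b) \<Longrightarrow> x \<in> tvars p \<union> tvars a \<union> tvars b"
  by (auto simp: is_pair_def Let_def dest!: fv_is_upairD)

lemma fv_pair_inD: "x \<in> fv (pair_in a b F) \<Longrightarrow> x \<in> tvars a \<union> tvars b \<union> tvars F"
  by (auto simp: pair_in_def Let_def dest!: fv_is_pairD)

lemma tvars_cpair: "tvars (cpair s t) = tvars s \<union> tvars t"
  by (auto simp: cpair_def)

lemma fv_is_funD: "x \<in> fv (is_fun F A B) \<Longrightarrow> x \<in> tvars F \<union> tvars A \<union> tvars B"
  by (auto simp: is_fun_def Let_def dest!: fv_is_pairD fv_pair_inD)

lemma fv_is_varD: "x \<in> fv (is_var v) \<Longrightarrow> x \<in> tvars v"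
  by (auto simp: is_var_def is_nat_def Let_def tvars_cpair)

lemma fv_is_VAD: "x \<in> fv (is_VA U f) \<Longrightarrow> x \<in> tvars U \<union> tvars f"
  by (auto simp: is_VA_def Let_def dest!: fv_is_pairD fv_is_funD fv_is_varD)

lemma fv_TrBoxD: "x \<in> fv (TrBox t) \<Longrightarrow> x \<in> tvars t"
  by (auto simp: TrBox_def Mod_all_def Let_def dest!: fv_is_VAD)

lemma sat_Imp: "sat M e (p \<^bold>\<longrightarrow> q) \<longleftrightarrow> (sat M e p \<longrightarrow> sat M e q)"
  by simp

lemma sat_Exists: "sat M e (\<^bold>\<exists>x. p) \<longleftrightarrow> (\<exists>d\<in>Dom M. sat M (e(x := d)) p)"
  by simp

lemma sat_conjs: "sat M e (conjs ps) \<longleftrightarrow> (\<forall>p\<in>set ps. sat M e p)"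
  by (induction ps) auto

lemmas fresh_simps = Let_def val_upd le_SucI trans_le_add1

section \<open>Semantic counterparts of the set-theoretic formulas\<close>

locale fm_structure =
  fixes M :: "'a model"
  assumes closed_ops: "closed_ops M"
begin

abbreviation "D \<equiv> Dom M"
abbreviation "E \<equiv> IMem M"

text \<open>Only the standard numbers; the domain may contain further elements satisfying
  \<open>s_nat\<close>.\<close>

primrec num :: "nat \<Rightarrow> 'a" where
  "num 0 = IZero M"
| "num (Suc n) = ISucc M (num n)"

lemma num_dom [simp]: "num n \<in> D"
  using closed_ops by (induction n) (auto simp: closed_ops_def)

lemma val_nm [simp]: "val M e (nm n) = num n"
  by (induction n) auto

lemma val_quote [simp]: "val M e \<lceil>p\<rceil> = num (gn p)"
  by (simp add: quote_def)

definition "s_cp a b = IPlus M (ITimes M (IPlus M a b) (IPlus M a b)) a"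

lemma val_cpair [simp]: "val M e (cpair s t) = s_cp (val M e s) (val M e t)"
  by (simp add: cpair_def s_cp_def)

definition "s_upair p a b \<longleftrightarrow> (\<forall>w\<in>D. E w p \<longleftrightarrow> w = a \<or> w = b)"

lemma sat_is_upair [simp]:
  "sat M e (is_upair p a b) \<longleftrightarrow> s_upair (val M e p) (val M e a) (val M e b)"
  by (auto simp: is_upair_def s_upair_def fresh_simps)

definition "s_pair p a b \<longleftrightarrow> (\<exists>s\<in>D. \<exists>t\<in>D. s_upair s a a \<and> s_upair t a b \<and> s_upair p s t)"

lemma sat_is_pair [simp]:
  "sat M e (is_pair p a b) \<longleftrightarrow> s_pair (val M e p) (val M e a) (val M e b)"
  by (simp add: is_pair_def s_pair_def fresh_simps)

definition "s_pair_in a b F \<longleftrightarrow> (\<exists>p\<in>D. s_pair p a b \<and> E p F)"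

lemma sat_pair_in [simp]:
  "sat M e (pair_in a b F) \<longleftrightarrow> s_pair_in (val M e a) (val M e b) (val M e F)"
  by (simp add: pair_in_def s_pair_in_def fresh_simps)

definition "s_fun F A B \<longleftrightarrow>
  (\<forall>p\<in>D. E p F \<longrightarrow> (\<exists>a\<in>D. \<exists>b\<in>D. E a A \<and> E b B \<and> s_pair p a b)) \<and>
  (\<forall>a\<in>D. E a A \<longrightarrow> (\<exists>b\<in>D. s_pair_in a b F \<and> (\<forall>c\<in>D. s_pair_in a c F \<longrightarrow> c = b)))"

lemma sat_is_fun [simp]:
  "sat M e (is_fun F A B) \<longleftrightarrow> s_fun (val M e F) (val M e A) (val M e B)"
  by (simp add: is_fun_def s_fun_def fresh_simps)

definition "s_nat n \<longleftrightarrow>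
  (\<forall>X\<in>D. E (IZero M) X \<and> (\<forall>y\<in>D. E y X \<longrightarrow> E (ISucc M y) X) \<longrightarrow> E n X)"

lemma sat_is_nat [simp]: "sat M e (is_nat n) \<longleftrightarrow> s_nat (val M e n)"
  by (simp add: is_nat_def s_nat_def fresh_simps sat_Imp
    del: sat.simps(5))

definition "s_var v \<longleftrightarrow> (\<exists>n\<in>D. s_nat n \<and> v = s_cp (num 0) n)"

lemma sat_is_var [simp]: "sat M e (is_var v) \<longleftrightarrow> s_var (val M e v)"
  by (simp add: is_var_def s_var_def fresh_simps)

text \<open>The literals are tags: \<open>Succ\<close>, \<open>DNeg\<close>, \<open>Numl\<close> in
  the unary group and \<open>Plus\<close>, \<open>Times\<close>, \<open>DConj\<close>,
  \<open>DAll\<close> in the binary one.\<close>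

definition "s_term_closed X \<longleftrightarrow>
  (\<forall>r\<in>D. s_var r \<longrightarrow> E r X) \<and> E (num (gnt Zero)) X \<and>
  (\<forall>k\<in>{2, 5, 8}. \<forall>r\<in>D. E r X \<longrightarrow> E (s_cp (num k) r) X) \<and>
  (\<forall>k\<in>{3, 4, 6, 7}. \<forall>r\<in>D. \<forall>s\<in>D. E r X \<and> E s X \<longrightarrow> E (s_cp (num k) (s_cp r s)) X)"

definition "s_term t \<longleftrightarrow> (\<forall>X\<in>D. s_term_closed X \<longrightarrow> E t X)"

lemma sat_is_term [simp]: "sat M e (is_term t) \<longleftrightarrow> s_term (val M e t)"
  by (simp add: is_term_def s_term_def s_term_closed_def sat_conjs fresh_simps sat_Imp
      del: sat.simps(5) nm.simps num.simps gnt.simps)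

definition "s_form_closed X \<longleftrightarrow>
  (\<forall>r\<in>D. \<forall>s\<in>D. s_term r \<and> s_term s \<longrightarrow> E (s_cp (num 9) (s_cp r s)) X) \<and>
  (\<forall>r\<in>D. \<forall>s\<in>D. s_term r \<and> s_term s \<longrightarrow> E (s_cp (num 10) (s_cp r s)) X) \<and>
  (\<forall>r\<in>D. s_term r \<longrightarrow> E (s_cp (num 11) r) X) \<and>
  (\<forall>r\<in>D. \<forall>s\<in>D. \<forall>t\<in>D. s_term r \<and> s_term s \<and> s_term t \<longrightarrow>
     E (s_cp (num 12) (s_cp r (s_cp s t))) X) \<and>
  (\<forall>r\<in>D. E r X \<longrightarrow> E (IDNeg M r) X) \<and>
  (\<forall>r\<in>D. \<forall>s\<in>D. E r X \<and> E s X \<longrightarrow> E (IDConj M r s) X) \<and>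
  (\<forall>r\<in>D. \<forall>s\<in>D. s_var r \<and> E s X \<longrightarrow> E (IDAll M r s) X)"

definition "s_form p \<longleftrightarrow> (\<forall>X\<in>D. s_form_closed X \<longrightarrow> E p X)"

lemma sat_is_form [simp]: "sat M e (is_form p) \<longleftrightarrow> s_form (val M e p)"
  by (simp add: is_form_def s_form_def s_form_closed_def fresh_simps sat_Imp
    del: sat.simps(5))

definition "s_VA U f \<longleftrightarrow> (\<exists>A\<in>D. \<exists>I\<in>D. \<exists>V\<in>D.
  s_pair U A I \<and> (\<forall>v\<in>D. E v V \<longleftrightarrow> s_var v) \<and> s_fun f V A)"

lemma sat_is_VA [simp]: "sat M e (is_VA U f) \<longleftrightarrow> s_VA (val M e U) (val M e f)"
  by (auto simp: is_VA_def s_VA_def fresh_simps)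

definition "s_TrBox c \<longleftrightarrow>
  (\<forall>U\<in>D. IUni M U \<longrightarrow> (\<forall>f\<in>D. s_VA U f \<longrightarrow> IMod M U c f))"

lemma sat_Mod_all [simp]:
  "sat M e (Mod_all U p) \<longleftrightarrow> (\<forall>f\<in>D. s_VA (val M e U) f \<longrightarrow> IMod M (val M e U) (val M e p) f)"
  by (simp add: Mod_all_def fresh_simps)

lemma sat_TrBox [simp]: "sat M e (TrBox p) \<longleftrightarrow> s_TrBox (val M e p)"
  by (simp add: TrBox_def s_TrBox_def fresh_simps)

lemma sat_is_structureD:
  assumes "sat M e (is_structure U)"
  shows "\<exists>A\<in>D. \<exists>I\<in>D. s_pair (val M e U) A I \<and> (\<exists>a\<in>D. E a A)"
  using assms by (auto simp: is_structure_def sat_conjs fresh_simps simp del: nm.simps)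

end

section \<open>Numerals and codes in models of \<open>CM_minus\<close>\<close>

locale CM_model = fm_structure +
  assumes ax: "q \<in> CM_minus \<Longrightarrow> models M q"
begin

lemma ax_sat: "q \<in> CM_minus \<Longrightarrow> (\<And>n. e n \<in> D) \<Longrightarrow> sat M e q"
  using ax by (simp add: models_def)

lemma zero_dom [simp]: "IZero M \<in> D"
  using num_dom[of 0] by simp

lemma symbol_axioms_sat:
  assumes "x \<in> D" "y \<in> D" "z \<in> D"
  shows "\<forall>q\<in>symbol_axioms. sat M ((\<lambda>_. x)(1 := y, 2 := z)) q"
  using assms by (auto intro!: ax_sat simp: CM_minus_def ZF_def)

lemma symbol_equations:
  assumes "x \<in> D" "y \<in> D"
  shows "s_nat x \<Longrightarrow> IPlus M x (IZero M) = x"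
    and "s_nat x \<Longrightarrow> s_nat y \<Longrightarrow> IPlus M x (ISucc M y) = ISucc M (IPlus M x y)"
    and "s_nat x \<Longrightarrow> ITimes M x (IZero M) = IZero M"
    and "s_nat x \<Longrightarrow> s_nat y \<Longrightarrow> ITimes M x (ISucc M y) = IPlus M (ITimes M x y) x"
    and "IDNeg M x = s_cp (num 13) x"
    and "IDConj M x y = s_cp (num 14) (s_cp x y)"
    and "IDAll M x y = s_cp (num 15) (s_cp x y)"
    and "INuml M (IZero M) = num (gnt Zero)"
    and "s_nat x \<Longrightarrow> INuml M (ISucc M x) = s_cp (num 2) (INuml M x)"
  using symbol_axioms_sat[OF assms assms(2)]
  by (simp_all add: symbol_axioms_def Let_def del: gnt.simps num.simps nm.simps)

lemma s_nat_num [simp]: "s_nat (num n)"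
  by (induction n) (auto simp: s_nat_def)

lemma plus_num [simp]: "IPlus M (num m) (num n) = num (m + n)"
proof (induction n)
  case 0
  then show ?case using symbol_equations(1)[of "num m" "num m"] by simp
next
  case (Suc n)
  then show ?case using symbol_equations(2)[of "num m" "num n"] by simp
qed

lemma times_num [simp]: "ITimes M (num m) (num n) = num (m * n)"
proof (induction n)
  case 0
  then show ?case using symbol_equations(3)[of "num m" "num m"] by simp
next
  case (Suc n)
  then show ?case using symbol_equations(4)[of "num m" "num n"] by (simp add: add.commute)
qed

lemma s_cp_num [simp]: "s_cp (num m) (num n) = num (npair m n)"
  by (simp add: s_cp_def npair_def)

text \<open>The recursion equations of \<open>Numl\<close> mirror those of \<open>gnt\<close> on
  numerals. This lets the object language name codes of numerals, as diagonalization
  requires.\<close>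

lemma Numl_num: "INuml M (num n) = num (gnt (nm n))"
proof (induction n)
  case 0
  then show ?case using symbol_equations(8)[of "IZero M" "IZero M"] by simp
next
  case (Suc n)
  then show ?case using symbol_equations(9)[of "num n" "num n"] by (simp del: numeral_2_eq_2)
qed

lemma s_var_num: "s_var (num (gnt (Var n)))"
  unfolding s_var_def by (intro bexI[of _ "num n"]) (simp_all del: num.simps)

lemma s_term_num: "s_term (num (gnt t))"
  unfolding s_term_def
proof (intro ballI impI)
  fix X assume "X \<in> D" and X: "s_term_closed X"
  have un: "E (num (npair k r)) X" if "E (num r) X" "k \<in> {2, 5, 8}" for k r
    using X that num_dom[of r] by (simp only: s_term_closed_def s_cp_num[symmetric])
  have bin: "E (num (npair k (npair r s))) X"
    if "E (num r) X" "E (num s) X" "k \<in> {3, 4, 6, 7}" for k r s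
    using X that num_dom[of r] num_dom[of s]
    by (simp only: s_term_closed_def s_cp_num[symmetric])
  show "E (num (gnt t)) X"
  proof (induction t)
    case (Var n)
    with X s_var_num show ?case by (simp add: s_term_closed_def del: gnt.simps)
  next
    case Zero
    with X show ?case by (simp add: s_term_closed_def del: gnt.simps)
  qed (simp_all add: un bin)
qed

lemma DNeg_num: "IDNeg M (num (gn p)) = num (gn (\<^bold>\<not> p))"
  using symbol_equations(5)[of "num (gn p)" "num 0"] by simp

lemma DConj_num: "IDConj M (num (gn p)) (num (gn q)) = num (gn (p \<^bold>\<and> q))"
  using symbol_equations(6)[of "num (gn p)" "num (gn q)"] by simp

lemma DAll_num: "IDAll M (num (gnt (Var x))) (num (gn p)) = num (gn (\<^bold>\<forall>x. p))"
  using symbol_equations(7)[of "num (gnt (Var x))" "num (gn p)"] by simp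

text \<open>Discharges the hypothesis \<open>is_form\<close> of the \<open>Mod\<close> clauses for
  actual formulas. Induction on \<open>p\<close> in the metatheory puts its code into every closed
  \<open>X\<close>.\<close>

lemma s_form_num: "s_form (num (gn p))"
  unfolding s_form_def
proof (intro ballI impI)
  fix X assume "X \<in> D" and X: "s_form_closed X"
  show "E (num (gn p)) X"
  proof (induction p)
    case (Eq s t)
    have "E (s_cp (num 9) (s_cp (num (gnt s)) (num (gnt t)))) X"
      using X by (simp add: s_form_closed_def s_term_num del: s_cp_num)
    then show ?case by simp
  next
    case (Mem s t)
    have "E (s_cp (num 10) (s_cp (num (gnt s)) (num (gnt t)))) X"
      using X by (simp add: s_form_closed_def s_term_num del: s_cp_num)
    then show ?case by simp
  next
    case (Uni t)
    have "E (s_cp (num 11) (num (gnt t))) X"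
      using X by (simp add: s_form_closed_def s_term_num del: s_cp_num)
    then show ?case by simp
  next
    case (Mod r s t)
    have "E (s_cp (num 12) (s_cp (num (gnt r)) (s_cp (num (gnt s)) (num (gnt t))))) X"
      using X by (simp add: s_form_closed_def s_term_num del: s_cp_num)
    then show ?case by simp
  next
    case (Neg p)
    then have "E (IDNeg M (num (gn p))) X"
      using X by (simp add: s_form_closed_def del: gn.simps)
    then show ?case by (simp only: DNeg_num)
  next
    case (Conj p q)
    then have "E (IDConj M (num (gn p)) (num (gn q))) X"
      using X by (simp add: s_form_closed_def del: gn.simps)
    then show ?case by (simp only: DConj_num)
  next
    case (Forall x p)
    then have "E (IDAll M (num (gnt (Var x))) (num (gn p))) X"
      using X s_var_num[of x] by (simp add: s_form_closed_def del: gn.simps gnt.simps)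
    then show ?case by (simp only: DAll_num)
  qed
qed

subsection \<open>Existence of variable assignments\<close>

lemma extensionality:
  assumes "x \<in> D" "y \<in> D" "\<And>z. z \<in> D \<Longrightarrow> E z x \<longleftrightarrow> E z y"
  shows "x = y"
proof -
  have "\<forall>q\<in>ZF_finite. sat M ((\<lambda>_. x)(1 := y)) q"
    using assms(1,2) by (auto intro!: ax_sat simp: CM_minus_def ZF_def)
  then show ?thesis using assms by (simp add: ZF_finite_def Let_def)
qed

lemma upair_ex: "x \<in> D \<Longrightarrow> y \<in> D \<Longrightarrow> \<exists>p\<in>D. s_upair p x y"
proof -
  assume xy: "x \<in> D" "y \<in> D"
  have "\<forall>q\<in>ZF_finite. sat M ((\<lambda>_. x)(1 := y)) q"
    using xy by (auto intro!: ax_sat simp: CM_minus_def ZF_def)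
  then show ?thesis by (simp add: ZF_finite_def Let_def)
qed

lemma infinity: "\<exists>A\<in>D. E (IZero M) A \<and> (\<forall>x\<in>D. E x A \<longrightarrow> E (ISucc M x) A)"
proof -
  have "\<forall>q\<in>ZF_finite. sat M (\<lambda>_. IZero M) q"
    by (auto intro!: ax_sat simp: CM_minus_def ZF_def)
  then show ?thesis by (simp add: ZF_finite_def Let_def)
qed

lemma pair_ex:
  assumes "x \<in> D" "y \<in> D"
  shows "\<exists>p\<in>D. s_pair p x y"
proof -
  obtain s t where "s \<in> D" "t \<in> D" "s_upair s x x" "s_upair t x y"
    using assms upair_ex by blast
  moreover from this obtain p where "p \<in> D" "s_upair p s t" using upair_ex by blast
  ultimately show ?thesis unfolding s_pair_def by blast
qed

definition "ext p = {w \<in> D. E w p}"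

lemma ext_inj: "x \<in> D \<Longrightarrow> y \<in> D \<Longrightarrow> ext x = ext y \<longleftrightarrow> x = y"
  using extensionality[of x y] by (auto simp: ext_def)

lemma s_upair_ext: "a \<in> D \<Longrightarrow> b \<in> D \<Longrightarrow> s_upair p a b \<longleftrightarrow> ext p = {a, b}"
  by (auto simp: s_upair_def ext_def)

text \<open>Reading members as HOL sets at both levels yields a Kuratowski pair of HOL, so
  injectivity reduces to equality of doubletons.\<close>

lemma s_pair_ext:
  assumes "s_pair p a b" "a \<in> D" "b \<in> D"
  shows "ext ` ext p = {{a}, {a, b}}"
  using assms by (auto simp: s_pair_def s_upair_ext)

lemma s_pair_inj:
  assumes "s_pair p a b" "s_pair p a' b'" "a \<in> D" "b \<in> D" "a' \<in> D" "b' \<in> D"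
  shows "b = b'"
  using s_pair_ext[of p a b] s_pair_ext[of p a' b'] assms by (auto simp: doubleton_eq_iff)

lemma s_pair_unique:
  assumes "s_pair p a b" "s_pair q a b" "p \<in> D" "q \<in> D" "a \<in> D" "b \<in> D"
  shows "p = q"
proof -
  obtain s t where st: "s \<in> D" "t \<in> D" "ext s = {a}" "ext t = {a, b}" "ext p = {s, t}"
    using assms by (auto simp: s_pair_def s_upair_ext)
  obtain s' t' where st': "s' \<in> D" "t' \<in> D" "ext s' = {a}" "ext t' = {a, b}" "ext q = {s', t'}"
    using assms by (auto simp: s_pair_def s_upair_ext)
  have "s = s'" "t = t'" using st st' ext_inj[of s s'] ext_inj[of t t'] by simp_all
  with st(5) st'(5) assms(3,4) ext_inj[of p q] show ?thesis by simp
qed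

text \<open>Separation from the set given by Infinity loses nothing, since \<open>s_nat\<close>
  places its elements in every inductive set.\<close>

lemma omega_ex: "\<exists>W\<in>D. \<forall>x\<in>D. E x W \<longleftrightarrow> s_nat x"
proof -
  obtain A where A: "A \<in> D" "E (IZero M) A \<and> (\<forall>x\<in>D. E x A \<longrightarrow> E (ISucc M x) A)"
    using infinity by blast
  have "(\<^bold>\<exists>2. \<^bold>\<forall>0. (Var 0 \<^bold>\<in> Var 2 \<^bold>\<longleftrightarrow> (Var 0 \<^bold>\<in> Var 1 \<^bold>\<and> is_nat (Var 0)))) \<in> Separation"
    unfolding Separation_def
    by (intro CollectI exI[of _ "is_nat (Var 0)"] exI[of _ 0] exI[of _ 1] exI[of _ 2])
      (simp add: is_nat_def Let_def)
  then have "sat M (\<lambda>_. A) (\<^bold>\<exists>2. \<^bold>\<forall>0. (Var 0 \<^bold>\<in> Var 2 \<^bold>\<longleftrightarrow> (Var 0 \<^bold>\<in> Var 1 \<^bold>\<and> is_nat (Var 0))))"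
    using A(1) by (intro ax_sat) (auto simp: CM_minus_def ZF_def)
  then obtain W where "W \<in> D" "\<forall>x\<in>D. E x W \<longleftrightarrow> E x A \<and> s_nat x" by auto
  moreover have "E x A" if "s_nat x" for x
    using that A unfolding s_nat_def by blast
  ultimately show ?thesis by blast
qed

text \<open>Variables are fixed once: \<open>0\<close> for the argument, \<open>1\<close> for the
  value, \<open>2\<close> to \<open>4\<close> for the axiom itself. Any other variable of
  \<open>p\<close> denotes the parameter \<open>d\<close>.\<close>

lemma replacement:
  assumes p: "fv p \<inter> {2, 3, 4} = {}" and dom: "A \<in> D" "d \<in> D"
    and functional: "\<And>x. x \<in> D \<Longrightarrow> E x A \<Longrightarrow>
      \<exists>z\<in>D. \<forall>y\<in>D. sat M ((\<lambda>_. d)(0 := x, 1 := y)) p \<longrightarrow> y = z"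
  shows "\<exists>B\<in>D. \<forall>y\<in>D. E y B \<longleftrightarrow> (\<exists>x\<in>D. E x A \<and> sat M ((\<lambda>_. d)(0 := x, 1 := y)) p)"
proof -
  let ?e = "(\<lambda>_. d)(3 := A)"
  let ?q = "(\<^bold>\<forall>0. (Var 0 \<^bold>\<in> Var 3 \<^bold>\<longrightarrow> (\<^bold>\<exists>2. \<^bold>\<forall>1. (p \<^bold>\<longrightarrow> Var 1 \<^bold>= Var 2)))) \<^bold>\<longrightarrow>
        (\<^bold>\<exists>4. \<^bold>\<forall>1. (Var 1 \<^bold>\<in> Var 4 \<^bold>\<longleftrightarrow> (\<^bold>\<exists>0. Var 0 \<^bold>\<in> Var 3 \<^bold>\<and> p)))"
  have "?q \<in> Replacement"
    unfolding Replacement_def using p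
    by (intro CollectI exI[of _ p] exI[of _ 0] exI[of _ 1] exI[of _ 2] exI[of _ 3] exI[of _ 4]) simp
  then have q: "sat M ?e ?q"
    using dom by (intro ax_sat) (auto simp: CM_minus_def ZF_def)
  have e1: "sat M (?e(0 := x, 2 := z, 1 := y)) p \<longleftrightarrow> sat M ((\<lambda>_. d)(0 := x, 1 := y)) p" for x y z
    by (rule sat_cong) (use p in auto)
  have e2: "sat M (?e(4 := b, 1 := y, 0 := x)) p \<longleftrightarrow> sat M ((\<lambda>_. d)(0 := x, 1 := y)) p" for x y b
    by (rule sat_cong) (use p in auto)
  let ?S = "\<lambda>x y. sat M ((\<lambda>_. d)(0 := x, 1 := y)) p"
  have "(\<forall>x\<in>D. E x A \<longrightarrow> (\<exists>z\<in>D. \<forall>y\<in>D. ?S x y \<longrightarrow> y = z)) \<longrightarrow>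
    (\<exists>B\<in>D. \<forall>y\<in>D. (E y B \<longrightarrow> (\<exists>x\<in>D. E x A \<and> ?S x y)) \<and> ((\<exists>x\<in>D. E x A \<and> ?S x y) \<longrightarrow> E y B))"
    using q by (simp only: sat_Imp sat_Exists sat.simps(1,2,6,7) val.simps e1 e2) simp
  moreover have "\<forall>x\<in>D. E x A \<longrightarrow> (\<exists>z\<in>D. \<forall>y\<in>D. ?S x y \<longrightarrow> y = z)"
    using functional by simp
  ultimately show ?thesis unfolding iff_conv_conj_imp by (rule mp)
qed

lemma var_set_ex: "\<exists>V\<in>D. \<forall>v\<in>D. E v V \<longleftrightarrow> s_var v"
proof -
  obtain W where W: "W \<in> D" "\<forall>x\<in>D. E x W \<longleftrightarrow> s_nat x" using omega_ex by blast
  \<comment> \<open>\<open>Zero\<close> is the numeral of \<open>tagVar\<close>, so the image of the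
    natural numbers consists of the codes of variables.\<close>
  let ?p = "Var 1 \<^bold>= cpair Zero (Var 0)"
  have "\<exists>B\<in>D. \<forall>y\<in>D. E y B \<longleftrightarrow> (\<exists>x\<in>D. E x W \<and> sat M ((\<lambda>_. W)(0 := x, 1 := y)) ?p)"
    by (rule replacement) (use W in \<open>auto simp: cpair_def\<close>)
  with W show ?thesis by (simp add: s_var_def)
qed

text \<open>The constant function is the image of \<open>V\<close> under pairing with
  \<open>d\<close>; Replacement applies because pairs are unique.\<close>

lemma constant_assignment_ex:
  assumes "V \<in> D" "A \<in> D" "d \<in> D" "E d A"
  shows "\<exists>f\<in>D. s_fun f V A"
proof -
  \<comment> \<open>\<open>Var 5\<close> is clear of the variables reserved in
    \<open>replacement\<close> and therefore denotes \<open>d\<close>.\<close>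
  let ?p = "is_pair (Var 1) (Var 0) (Var 5)"
  have "\<exists>f\<in>D. \<forall>y\<in>D. E y f \<longleftrightarrow> (\<exists>x\<in>D. E x V \<and> sat M ((\<lambda>_. d)(0 := x, 1 := y)) ?p)"
  proof (rule replacement)
    show "fv ?p \<inter> {2, 3, 4} = {}" by (auto dest!: fv_is_pairD)
    fix x assume "x \<in> D"
    then obtain z where "z \<in> D" "s_pair z x d" using pair_ex assms(3) by blast
    then show "\<exists>z\<in>D. \<forall>y\<in>D. sat M ((\<lambda>_. d)(0 := x, 1 := y)) ?p \<longrightarrow> y = z"
      using s_pair_unique \<open>x \<in> D\<close> assms(3) by (intro bexI[of _ z]) auto
  qed (use assms in auto)
  then obtain f where f: "f \<in> D" "\<And>y. y \<in> D \<Longrightarrow> E y f \<longleftrightarrow> (\<exists>x\<in>D. E x V \<and> s_pair y x d)"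
    by auto
  have "s_fun f V A"
    unfolding s_fun_def
  proof (intro conjI ballI impI)
    fix p assume "p \<in> D" "E p f"
    then show "\<exists>a\<in>D. \<exists>b\<in>D. E a V \<and> E b A \<and> s_pair p a b"
      using f(2) assms by blast
  next
    fix a assume a: "a \<in> D" "E a V"
    then obtain p where p: "p \<in> D" "s_pair p a d" using pair_ex assms(3) by blast
    then have "s_pair_in a d f" unfolding s_pair_in_def using f(2) a by blast
    moreover have "c = d" if "c \<in> D" "s_pair_in a c f" for c
      using that f(2) a(1) assms(3) s_pair_inj unfolding s_pair_in_def by metis
    ultimately show "\<exists>b\<in>D. s_pair_in a b f \<and> (\<forall>c\<in>D. s_pair_in a c f \<longrightarrow> c = b)"
      using assms(3) by blast
  qed
  with f(1) show ?thesis by blast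
qed

text \<open>A universe has a non-empty domain, hence a constant assignment. Otherwise truth under
  all assignments could be vacuous and yield no contradiction.\<close>

lemma assignment_ex:
  assumes "U \<in> D" "IUni M U"
  shows "\<exists>f\<in>D. s_VA U f"
proof -
  have "\<forall>q\<in>Str. sat M (\<lambda>_. U) q"
    using assms by (auto intro!: ax_sat simp: CM_minus_def)
  then have "sat M (\<lambda>_. U) (Uni (Var 0) \<^bold>\<longrightarrow> is_structure (Var 0))"
    by (simp only: Str_def Let_def ball_simps)
  then have "sat M (\<lambda>_. U) (is_structure (Var 0))"
    using assms by simp
  from sat_is_structureD[OF this] obtain A I d
    where A: "A \<in> D" "I \<in> D" "s_pair U A I" "d \<in> D" "E d A"
    by auto
  obtain V where V: "V \<in> D" "\<forall>v\<in>D. E v V \<longleftrightarrow> s_var v" using var_set_ex by blast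
  obtain f where "f \<in> D" "s_fun f V A"
    using constant_assignment_ex[OF V(1) A(1) A(4,5)] by blast
  with A V show ?thesis unfolding s_VA_def by (intro bexI[of _ f] bexI[of _ A] bexI[of _ I] bexI[of _ V]) simp_all
qed

lemma Mod_connectives:
  assumes "U \<in> D" "IUni M U" "f \<in> D" "s_VA U f"
  shows "IMod M U (num (gn (\<^bold>\<not> p))) f \<longleftrightarrow> \<not> IMod M U (num (gn p)) f"
    and "IMod M U (num (gn (p \<^bold>\<and> q))) f \<longleftrightarrow> IMod M U (num (gn p)) f \<and> IMod M U (num (gn q)) f"
proof -
  \<comment> \<open>In \<open>Mod_axioms\<close> the variables \<open>0\<close>, \<open>1\<close>,
    \<open>2\<close>, \<open>6\<close> stand for the universe, the two formulas and the
    assignment.\<close>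
  have "\<forall>r\<in>Mod_axioms. sat M ((\<lambda>_. U)(1 := num (gn p), 2 := num (gn q), 6 := f)) r"
    using assms by (auto intro!: ax_sat simp: CM_minus_def)
  then show "IMod M U (num (gn (\<^bold>\<not> p))) f \<longleftrightarrow> \<not> IMod M U (num (gn p)) f"
    and "IMod M U (num (gn (p \<^bold>\<and> q))) f \<longleftrightarrow> IMod M U (num (gn p)) f \<and> IMod M U (num (gn q)) f"
    unfolding Mod_axioms_def Let_def ball_simps
    using assms by (simp_all add: s_form_num DNeg_num DConj_num del: gn.simps) argo+
qed

end

section \<open>The liar\<close>

text \<open>When \<open>t\<close> denotes the code of \<open>p\<close>, \<open>diag t\<close> denotes the code of
  \<open>\<^bold>\<forall>0. Var 0 \<^bold>= \<lceil>p\<rceil> \<^bold>\<longrightarrow> p\<close>, which says of the code of \<open>p\<close> what \<open>p\<close> says of \<open>Var 0\<close>.\<close>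

definition diag :: "tm \<Rightarrow> tm" where
  "diag t = DAll (nm (gnt (Var 0))) (DNeg (DConj (cEq (nm (gnt (Var 0))) (Numl t)) (DNeg t)))"

definition liar_body :: fm where
  "liar_body = \<^bold>\<not> TrBox (diag (Var 0))"

text \<open>The diagonalization of \<open>liar_body\<close>. Using an equation as guard instead of a
  substitution means that its code is built with the dotted connectives and \<open>Numl\<close>
  alone.\<close>

definition liar :: fm where
  "liar = (\<^bold>\<forall>0. Var 0 \<^bold>= \<lceil>liar_body\<rceil> \<^bold>\<longrightarrow> liar_body)"

lemma sentence_liar: "sentence liar"
  by (auto simp: sentence_def liar_def liar_body_def quote_def diag_def tvars_cpair dest!: fv_TrBoxD)

lemma sentence_TrBox_quote: "sentence (TrBox \<lceil>p\<rceil>)"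
  by (auto simp: sentence_def quote_def dest!: fv_TrBoxD)


context CM_model
begin

lemma diag_num:
  assumes "val M e t = num (gn p)"
  shows "val M e (diag t) = num (gn (\<^bold>\<forall>0. Var 0 \<^bold>= \<lceil>p\<rceil> \<^bold>\<longrightarrow> p))"
proof -
  let ?q = "\<^bold>\<not> (Var 0 \<^bold>= \<lceil>p\<rceil> \<^bold>\<and> \<^bold>\<not> p)"
  have "s_cp (num 9) (s_cp (num (gnt (Var 0))) (num (gnt \<lceil>p\<rceil>))) = num (gn (Var 0 \<^bold>= \<lceil>p\<rceil>))"
    by (simp only: s_cp_num gn.simps)
  then show ?thesis
    unfolding diag_def val.simps val_cpair val_nm assms Numl_num quote_def[symmetric]
    by (simp only: DNeg_num DConj_num DAll_num)
qed

text \<open>The guard fixes \<open>Var 0\<close> as the code of \<open>liar_body\<close>, where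
  \<open>diag\<close> denotes the code of \<open>liar\<close>; the fixed point is thus computed in
  each model.\<close>

lemma sat_liar: "sat M e liar \<longleftrightarrow> \<not> s_TrBox (num (gn liar))"
proof -
  have "val M (e(0 := num (gn liar_body))) (diag (Var 0)) = num (gn liar)"
    unfolding liar_def by (rule diag_num) simp
  then have "sat M (e(0 := num (gn liar_body))) liar_body \<longleftrightarrow> \<not> s_TrBox (num (gn liar))"
    by (simp add: liar_body_def)
  then show ?thesis
    by (subst liar_def) simp
qed

end

section \<open>Inconsistency of the two systems\<close>

lemma CM_completeness:
  assumes "CM_minus \<subseteq> Ax"
    and "\<And>(M :: tm model) e. CM_model M \<Longrightarrow> (\<And>q. derives_NEC Ax {} q \<Longrightarrow> models M q) \<Longrightarrow> sat M e p"
  shows "derives_NEC Ax {} p"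
proof (rule completeness)
  fix M :: "tm model" and e
  assume M: "closed_ops M" "\<And>q. derives_NEC Ax {} q \<Longrightarrow> models M q"
  have "CM_model M"
    using M assms(1) by unfold_locales (auto intro: derives_NEC.Axiom)
  then show "sat M e p" using M(2) by (rule assms(2))
qed

text \<open>By \<open>sat_liar\<close> the assumption makes \<open>liar\<close> hold in all these
  models, so completeness gives it as a theorem from no assumptions, ready for
  \<open>NEC\<close>.\<close>

lemma inconsistent_if_not_TrBox_liar:
  assumes "CM_minus \<subseteq> Ax"
    and "\<And>M :: tm model. CM_model M \<Longrightarrow> (\<And>q. derives_NEC Ax {} q \<Longrightarrow> models M q) \<Longrightarrow>
      \<not> fm_structure.s_TrBox M (fm_structure.num M (gn liar))"
  shows "inconsistent_NEC Ax"
proof -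
  have "derives_NEC Ax {} (\<^bold>\<not> TrBox \<lceil>liar\<rceil>)"
  proof (rule CM_completeness[OF assms(1)])
    fix M :: "tm model" and e
    assume M: "CM_model M" and "\<And>q. derives_NEC Ax {} q \<Longrightarrow> models M q"
    then have *: "\<not> fm_structure.s_TrBox M (fm_structure.num M (gn liar))" by (rule assms(2))
    interpret CM_model M by (rule M)
    show "sat M e (\<^bold>\<not> TrBox \<lceil>liar\<rceil>)" using * by simp
  qed
  moreover have "derives_NEC Ax {} liar"
  proof (rule CM_completeness[OF assms(1)])
    fix M :: "tm model" and e
    assume M: "CM_model M" and "\<And>q. derives_NEC Ax {} q \<Longrightarrow> models M q"
    then have "\<not> fm_structure.s_TrBox M (fm_structure.num M (gn liar))" by (rule assms(2))
    then show "sat M e liar" using CM_model.sat_liar[OF M] by blast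
  qed
  then have "derives_NEC Ax {} (TrBox \<lceil>liar\<rceil>)"
    by (rule derives_NEC.NEC[OF _ sentence_liar])
  ultimately show ?thesis
    unfolding inconsistent_NEC_def provable_NEC_def by blast
qed

lemma inconsistent_T: "inconsistent_NEC (CM_minus \<union> T_CM)"
proof (rule inconsistent_if_not_TrBox_liar)
  fix M :: "tm model"
  assume M: "CM_model M" and thms: "\<And>q. derives_NEC (CM_minus \<union> T_CM) {} q \<Longrightarrow> models M q"
  interpret CM_model M by (rule M)
  have "derives_NEC (CM_minus \<union> T_CM) {} (TrBox \<lceil>liar\<rceil> \<^bold>\<longrightarrow> liar)"
    using sentence_liar by (intro derives_NEC.Axiom) (auto simp: T_CM_def)
  then have "models M (TrBox \<lceil>liar\<rceil> \<^bold>\<longrightarrow> liar)" by (rule thms)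
  then have "sat M (\<lambda>_. IZero M) (TrBox \<lceil>liar\<rceil> \<^bold>\<longrightarrow> liar)"
    unfolding models_def by (rule allE) (erule mp, simp)
  then show "\<not> s_TrBox (num (gn liar))" by (simp add: sat_liar)
qed simp

lemma inconsistent_4: "inconsistent_NEC (CM_minus \<union> {Non_Triviality} \<union> Four_CM)"
proof (rule inconsistent_if_not_TrBox_liar)
  let ?Ax = "CM_minus \<union> {Non_Triviality} \<union> Four_CM"
  let ?q = "\<^bold>\<not> (liar \<^bold>\<and> TrBox \<lceil>liar\<rceil>)"
  \<comment> \<open>By \<open>sat_liar\<close> the two conjuncts exclude each other in every model
    of \<open>CM_minus\<close>; as a theorem, \<open>?q\<close> can be necessitated.\<close>
  have "derives_NEC ?Ax {} ?q"
  proof (rule CM_completeness)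
    fix M :: "tm model" and e
    assume M: "CM_model M"
    interpret CM_model M by (rule M)
    show "sat M e ?q" by (simp add: sat_liar)
  qed auto
  then have nec: "derives_NEC ?Ax {} (TrBox \<lceil>?q\<rceil>)"
    using sentence_liar sentence_TrBox_quote[of liar]
    by (intro derives_NEC.NEC) (simp_all add: sentence_def)
  fix M :: "tm model"
  assume M: "CM_model M" and thms: "\<And>q. derives_NEC ?Ax {} q \<Longrightarrow> models M q"
  interpret CM_model M by (rule M)
  have thm_sat: "sat M (\<lambda>_. IZero M) q" if "derives_NEC ?Ax {} q" for q
    using thms[OF that] by (simp add: models_def)
  show "\<not> s_TrBox (num (gn liar))"
  proof
    assume liar: "s_TrBox (num (gn liar))"
    have "sat M (\<lambda>_. IZero M) (TrBox \<lceil>liar\<rceil> \<^bold>\<longrightarrow> TrBox \<lceil>TrBox \<lceil>liar\<rceil>\<rceil>)"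
      using sentence_liar by (intro thm_sat derives_NEC.Axiom) (auto simp: Four_CM_def)
    with liar have TrBox_liar: "s_TrBox (num (gn (TrBox \<lceil>liar\<rceil>)))" by simp
    have q: "s_TrBox (num (gn ?q))" using thm_sat[OF nec] by simp
    have "sat M (\<lambda>_. IZero M) Non_Triviality"
      by (intro thm_sat derives_NEC.Axiom) simp
    then obtain U where U: "U \<in> D" "IUni M U" by (auto simp: Non_Triviality_def)
    then obtain f where f: "f \<in> D" "s_VA U f" using assignment_ex by blast
    \<comment> \<open>All three truths are evaluated at the same \<open>U\<close> and
      \<open>f\<close>, where \<open>Mod_connectives\<close> makes them clash
      propositionally.\<close>
    from liar TrBox_liar q U f
    have "IMod M U (num (gn liar)) f" "IMod M U (num (gn (TrBox \<lceil>liar\<rceil>))) f"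
      "IMod M U (num (gn ?q)) f"
      unfolding s_TrBox_def by blast+
    then show False by (simp add: Mod_connectives[OF U f] del: gn.simps)
  qed
qed auto

theorem theorem4p6:
  shows "inconsistent_NEC (CM_minus \<union> T_CM) \<and>
         inconsistent_NEC (CM_minus \<union> {Non_Triviality} \<union> Four_CM)"
  using inconsistent_T inconsistent_4 ..

end
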